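(* Suppose that for every $t\in\mathbb N$ the control set is $$U_t=\bigcap_{1\le k\le m}\{u\in\mathbb R^d: g_t^k(u)\ge0\},$$ where $g_t^k:\mathbb R^d\to\mathbb R$ for $k\in\{1,\dots,m\}$. Let $j\in\{1,2,3\}$ and let $(\underline{\hat x},\underline{\hat u})=((\hat x_t)_{t\in\mathbb N},(\hat u_t)_{t\in\mathbb N})$ be a solution of problem $(P^j_i)$ (defined in the context). Consider the following assumptions. (i) For all $t\in\mathbb N$, $\phi_t$ and $f_t$ are Gâteaux differentiable at $(\hat x_t,\hat u_t)$. (ii) For all $t\in\mathbb N$ and all $k\in\{1,\dots,m\}$, $g_t^k$ is Gâteaux differentiable at $\hat u_t$. (iii) For all $t\in\mathbb N$ and all $\alpha\in\{1,\dots,n\}$, $f_t^\alpha$ is lower semicontinuous at $(\hat x_t,\hat u_t)$ when $f_t^\alpha(\hat x_t,\hat u_t)>\hat x_{t+1}^\alpha$. (iv) For all $t\in\mathbb N$ and all $k\in\{1,\dots,m\}$, $g_t^k$ is lower semicontinuous at $\hat u_t$ when $g_t^k(\hat u_t)>0$. (v) For all $t\in\mathbb N$, $0\notin \mathrm{co}\{D_Gg_t^k(\hat u_t):k\in I_t^s\}$, where $I_t^s:=\{k\in\{1,\dots,m\}:g_t^k(\hat u_t)=0\}$. (vi) For all $t\in\mathbb N_*$, $D_{G,1}f_t(\hat x_t,\hat u_t)$ is invertible. (vii) For all $t\in\mathbb N_*$: $\frac{\partial f_t^\alpha(\hat x_t,\hat u_t)}{\partial x^\beta}\ge0$ for all $\alpha,\beta\in\{1,\dots,n\}$,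 and $\frac{\partial f_t^\alpha(\hat x_t,\hat u_t)}{\partial x^\alpha}>0$ for all $\alpha\in\{1,\dots,n\}$. Assume either (i)–(vi), or (i)–(v) and (vii). Then there exist $\lambda_0\in\mathbb R$, $(p_t)_{t\in\mathbb N_*}\in(\mathbb R^{n*})^{\mathbb N_*}$, and $(\mu_t^1)_{t\in\mathbb N},\dots,(\mu_t^m)_{t\in\mathbb N}\in\mathbb R^{\mathbb N}$ such that: (NN) $(\lambda_0,p_1)\ne(0,0)$. (Si) $\lambda_0\ge0$, $p_t\ge0$ for all $t\in\mathbb N_*$, and $\mu_t^k\ge0$ for all $t\in\mathbb N$ and all $k\in\{1,\dots,m\}$. (S$\ell$) For all $t\in\mathbb N$: $p_{t+1}^\alpha\cdot(f_t^\alpha(\hat x_t,\hat u_t)-\hat x_{t+1}^\alpha)=0$ for all $\alpha\in\{1,\dots,n\}$, and $\mu_t^k\cdot g_t^k(\hat u_t)=0$ for all $k\in\{1,\dots,m\}$. (AE) For all $t\in\mathbb N_*$, $p_t=p_{t+1}\circ D_{G,1}f_t(\hat x_t,\hat u_t)+\lambda_0D_{G,1}\phi_t(\hat x_t,\hat u_t)$. (WM) For all $t\in\mathbb N$, $p_{t+1}\circ D_{G,2}f_t(\hat x_t,\hat u_t)+\lambda_0D_{G,2}\phi_t(\hat x_t,\hat u_t)+\sum_{k=1}^m\mu_t^kD_Gg_t^k(\hat u_t)=0$.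
   Context: $\mathbb N=\{0,1,2,\dots\}$, $\mathbb N_*=\mathbb N\setminus\{0\}$; $\mathrm{co}$ denotes convex hull. For each $t\in\mathbb N$, $X_t$ is a nonempty open subset of $\mathbb R^n$, $U_t$ is a nonempty subset of $\mathbb R^d$, $f_t:X_t\times U_t\to X_{t+1}$ is a mapping (with coordinates $f_t^\alpha$, $1\le\alpha\le n$), and $\phi_t:X_t\times U_t\to\mathbb R$ is a function. A point $\sigma\in X_0$ is fixed. The order on $\mathbb R^n$ is coordinatewise: $x\le y$ iff $x^\alpha\le y^\alpha$ for all $\alpha$. $\mathbb R^{n*}$ is the dual of $\mathbb R^n$; $p\in\mathbb R^{n*}$ has coordinates $p^\alpha$ in the canonical dual basis and $p\ge 0$ means $p^\alpha\ge0$ for all $\alpha$. $\mathrm{Adm}_i$ is the set of $(\underline x,\underline u)=((x_t)_{t\in\mathbb N},(u_t)_{t\in\mathbb N})\in\prod_{t\in\mathbb N}X_t\times\prod_{t\in\mathbb N}U_t$ such that $x_0=\sigma$ and $x_{t+1}\le f_t(x_t,u_t)$ for all $t\in\mathbb N$. $\mathrm{Dom}_i$ is the set of $(\underline x,\underline u)\in\mathrm{Adm}_i$ such that the series $\sum_{t=0}^{+\infty}\phi_t(x_t,u_t)$ converges in $\mathbb R$, and $J(\underline x,\underline u):=\sum_{t=0}^{+\infty}\phi_t(x_t,u_t)$ on $\mathrm{Dom}_i$. The problems are: $(P^1_i)$: maximize $J(\underline x,\underline u)$ over $(\underline x,\underline u)\in\mathrm{Dom}_i$. $(P^2_i)$: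 find $(\underline{\hat x},\underline{\hat u})\in\mathrm{Adm}_i$ such that for all $(\underline x,\underline u)\in\mathrm{Adm}_i$, $\limsup_{h\to+\infty}\left(\sum_{t=0}^h\phi_t(\hat x_t,\hat u_t)-\sum_{t=0}^h\phi_t(x_t,u_t)\right)\ge0$. $(P^3_i)$: the same with $\liminf$ in place of $\limsup$. Gâteaux differentiability: for finite-dimensional real normed spaces $E,F$, $A\subset E$, $\Phi:A\to F$ and $a\in A$, $\Phi$ is Gâteaux differentiable at $a$ when for all $v\in E$ the limit $\vec D\Phi(a,v):=\lim_{s\to0}\frac1s(\Phi(a+sv)-\Phi(a))$ exists and $v\mapsto\vec D\Phi(a,v)$ is linear; then $D_G\Phi(a)v:=\vec D\Phi(a,v)$. If $E=E_1\times E_2$ and $a=(a_1,a_2)$, $D_{G,1}\Phi(a)$ (resp. $D_{G,2}\Phi(a)$) is the Gâteaux differential of $\Phi(\cdot,a_2)$ at $a_1$ (resp. of $\Phi(a_1,\cdot)$ at $a_2$). The numbers $\frac{\partial f_t^\alpha(\hat x_t,\hat u_t)}{\partial x^\beta}$ are the entries of the matrix of $D_{G,1}f_t(\hat x_t,\hat u_t)$. *)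

theory Defs
  imports "HOL-Analysis.Analysis"
begin

text \<open>
  The function is only known on \<open>A\<close>, so the limit as \<open>s\<close> tends to 0 is taken over those
  \<open>s \<noteq> 0\<close> with \<open>a + s v \<in> A\<close>. If \<open>A\<close> contains a neighbourhood of \<open>a\<close> (always so for the
  functions \<open>g\<close>, where \<open>A = UNIV\<close>), this is the usual two-sided limit. At a boundary point
  of \<open>A\<close>, a direction \<open>v\<close> that leaves \<open>A\<close> immediately on both sides imposes no condition.
  Linear maps between finite-dimensional spaces are bounded, hence the type of \<open>D\<close>.
\<close>

definition has_gateaux_derivative ::
  "('a::euclidean_space \<Rightarrow> 'b::euclidean_space) \<Rightarrow> ('a \<Rightarrow>\<^sub>L 'b) \<Rightarrow> 'a set \<Rightarrow> 'a \<Rightarrow> bool" where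
  "has_gateaux_derivative \<Phi> D A a \<longleftrightarrow>
     (\<forall>v. ((\<lambda>s. (1 / s) *\<^sub>R (\<Phi> (a + s *\<^sub>R v) - \<Phi> a)) \<longlongrightarrow> blinfun_apply D v)
            (at 0 within {s::real. a + s *\<^sub>R v \<in> A}))"

definition gateaux_differentiable ::
  "('a::euclidean_space \<Rightarrow> 'b::euclidean_space) \<Rightarrow> 'a set \<Rightarrow> 'a \<Rightarrow> bool" where
  "gateaux_differentiable \<Phi> A a \<longleftrightarrow> (\<exists>D. has_gateaux_derivative \<Phi> D A a)"

text \<open>
  The derivative is unique as soon as the directions pointing from \<open>a\<close> into \<open>A\<close> span the
  space. For \<open>A = X \<times> U\<close> with \<open>X\<close> open and \<open>U = {u. \<forall>k\<in>{1..m}. g k u \<ge> 0}\<close> this follows from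
  the constraint qualification \<open>0 \<notin> co {D g k : k active}\<close> together with lower
  semicontinuity of the inactive \<open>g k\<close>.
\<close>

definition DG ::
  "('a::euclidean_space \<Rightarrow> 'b::euclidean_space) \<Rightarrow> 'a set \<Rightarrow> 'a \<Rightarrow> ('a \<Rightarrow>\<^sub>L 'b)" where
  "DG \<Phi> A a = (THE D. has_gateaux_derivative \<Phi> D A a)"

definition DG1 ::
  "('a::euclidean_space \<times> 'c::euclidean_space \<Rightarrow> 'b::euclidean_space) \<Rightarrow>
     ('a \<times> 'c) set \<Rightarrow> 'a \<times> 'c \<Rightarrow> ('a \<Rightarrow>\<^sub>L 'b)" where
  "DG1 \<Phi> A a = DG (\<lambda>y. \<Phi> (y, snd a)) {y. (y, snd a) \<in> A} (fst a)"

definition DG2 ::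
  "('a::euclidean_space \<times> 'c::euclidean_space \<Rightarrow> 'b::euclidean_space) \<Rightarrow>
     ('a \<times> 'c) set \<Rightarrow> 'a \<times> 'c \<Rightarrow> ('c \<Rightarrow>\<^sub>L 'b)" where
  "DG2 \<Phi> A a = DG (\<lambda>w. \<Phi> (fst a, w)) {w. (fst a, w) \<in> A} (snd a)"

definition lsc_at :: "('a::topological_space \<Rightarrow> real) \<Rightarrow> 'a set \<Rightarrow> 'a \<Rightarrow> bool" where
  "lsc_at \<Phi> A a \<longleftrightarrow> (\<forall>c<\<Phi> a. \<forall>\<^sub>F y in at a within A. c < \<Phi> y)"

definition Adm ::
  "(nat \<Rightarrow> (real^'n) set) \<Rightarrow> (nat \<Rightarrow> (real^'d) set) \<Rightarrow>
   (nat \<Rightarrow> (real^'n) \<times> (real^'d) \<Rightarrow> real^'n) \<Rightarrow> real^'n \<Rightarrow>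
   ((nat \<Rightarrow> real^'n) \<times> (nat \<Rightarrow> real^'d)) set" where
  "Adm X U f \<sigma> = {(x, u). (\<forall>t. x t \<in> X t) \<and> (\<forall>t. u t \<in> U t) \<and>
                          x 0 = \<sigma> \<and> (\<forall>t. x (Suc t) \<le> f t (x t, u t))}"

definition Dom ::
  "(nat \<Rightarrow> (real^'n) set) \<Rightarrow> (nat \<Rightarrow> (real^'d) set) \<Rightarrow>
   (nat \<Rightarrow> (real^'n) \<times> (real^'d) \<Rightarrow> real^'n) \<Rightarrow>
   (nat \<Rightarrow> (real^'n) \<times> (real^'d) \<Rightarrow> real) \<Rightarrow> real^'n \<Rightarrow>
   ((nat \<Rightarrow> real^'n) \<times> (nat \<Rightarrow> real^'d)) set" where
  "Dom X U f \<phi> \<sigma> = {(x, u) \<in> Adm X U f \<sigma>. summable (\<lambda>t. \<phi> t (x t, u t))}"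

definition J ::
  "(nat \<Rightarrow> (real^'n) \<times> (real^'d) \<Rightarrow> real) \<Rightarrow>
   (nat \<Rightarrow> real^'n) \<Rightarrow> (nat \<Rightarrow> real^'d) \<Rightarrow> real" where
  "J \<phi> x u = (\<Sum>t. \<phi> t (x t, u t))"

definition solves_P1 ::
  "(nat \<Rightarrow> (real^'n) set) \<Rightarrow> (nat \<Rightarrow> (real^'d) set) \<Rightarrow>
   (nat \<Rightarrow> (real^'n) \<times> (real^'d) \<Rightarrow> real^'n) \<Rightarrow>
   (nat \<Rightarrow> (real^'n) \<times> (real^'d) \<Rightarrow> real) \<Rightarrow> real^'n \<Rightarrow>
   (nat \<Rightarrow> real^'n) \<Rightarrow> (nat \<Rightarrow> real^'d) \<Rightarrow> bool" where
  "solves_P1 X U f \<phi> \<sigma> x' u' \<longleftrightarrow>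
     (x', u') \<in> Dom X U f \<phi> \<sigma> \<and> (\<forall>(x, u) \<in> Dom X U f \<phi> \<sigma>. J \<phi> x u \<le> J \<phi> x' u')"

definition solves_P2 ::
  "(nat \<Rightarrow> (real^'n) set) \<Rightarrow> (nat \<Rightarrow> (real^'d) set) \<Rightarrow>
   (nat \<Rightarrow> (real^'n) \<times> (real^'d) \<Rightarrow> real^'n) \<Rightarrow>
   (nat \<Rightarrow> (real^'n) \<times> (real^'d) \<Rightarrow> real) \<Rightarrow> real^'n \<Rightarrow>
   (nat \<Rightarrow> real^'n) \<Rightarrow> (nat \<Rightarrow> real^'d) \<Rightarrow> bool" where
  "solves_P2 X U f \<phi> \<sigma> x' u' \<longleftrightarrow>
     (x', u') \<in> Adm X U f \<sigma> \<and>
     (\<forall>(x, u) \<in> Adm X U f \<sigma>.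
        limsup (\<lambda>h. ereal ((\<Sum>t=0..h. \<phi> t (x' t, u' t)) - (\<Sum>t=0..h. \<phi> t (x t, u t)))) \<ge> 0)"

definition solves_P3 ::
  "(nat \<Rightarrow> (real^'n) set) \<Rightarrow> (nat \<Rightarrow> (real^'d) set) \<Rightarrow>
   (nat \<Rightarrow> (real^'n) \<times> (real^'d) \<Rightarrow> real^'n) \<Rightarrow>
   (nat \<Rightarrow> (real^'n) \<times> (real^'d) \<Rightarrow> real) \<Rightarrow> real^'n \<Rightarrow>
   (nat \<Rightarrow> real^'n) \<Rightarrow> (nat \<Rightarrow> real^'d) \<Rightarrow> bool" where
  "solves_P3 X U f \<phi> \<sigma> x' u' \<longleftrightarrow>
     (x', u') \<in> Adm X U f \<sigma> \<and>
     (\<forall>(x, u) \<in> Adm X U f \<sigma>.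
        liminf (\<lambda>h. ereal ((\<Sum>t=0..h. \<phi> t (x' t, u' t)) - (\<Sum>t=0..h. \<phi> t (x t, u t)))) \<ge> 0)"

definition dual_coord :: "((real^'n) \<Rightarrow>\<^sub>L real) \<Rightarrow> 'n \<Rightarrow> real" where
  "dual_coord p \<alpha> = blinfun_apply p (axis \<alpha> 1)"

end

theory Submission
  imports Defs
begin

text \<open>
  Fix a horizon \<open>h\<close> and perturb the optimal process only up to time \<open>h\<close>, keeping the state at
  \<open>h + 1\<close>. All constraints are inequalities, so if some direction increased the objective and every
  active constraint to first order, a small step along it would be admissible (the inactive
  constraints survive by lower semicontinuity) and strictly better. Gordan's alternative therefore
  gives multipliers for each \<open>h\<close>. The adjoint equation together with (vi) or (vii) bounds
  \<open>p (Suc t)\<close> by \<open>l0\<close> and \<open>p 1\<close> uniformly in \<open>h\<close>; hence \<open>(l0, p 1)\<close> can be normalised and Tychonoff's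
  theorem yields multipliers valid for all horizons at once. The multipliers \<open>\<mu>\<close> are recovered at the
  end, separately at each time, from the constraint qualification (v).
\<close>

section \<open>Gordan's alternative\<close>

text \<open>\<open>T\<close> misses the open positive quadrant, so a line separates them. The
  quadrant is unbounded in both coordinate directions, which makes the normal nonnegative, and it
  comes arbitrarily close to the origin, which makes the threshold at most 0. This is the
  two-constraint case that drives the induction below.\<close>

lemma separate_open_quadrant:
  fixes T :: "(real \<times> real) set"
  assumes "convex T" "T \<noteq> {}" and T: "\<And>x y. (x, y) \<in> T \<Longrightarrow> x \<le> 0 \<or> y \<le> 0"
  obtains \<alpha> \<beta> :: real where "\<alpha> \<ge> 0" "\<beta> \<ge> 0" "\<alpha> + \<beta> = 1"
    "\<And>x y. (x, y) \<in> T \<Longrightarrow> \<alpha> * x + \<beta> * y \<le> 0"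
proof -
  let ?Q = "{0<..} \<times> {0<..} :: (real \<times> real) set"
  have "convex ?Q" by (intro convex_Times) auto
  moreover have "?Q \<noteq> {}" by (auto intro: exI[of _ 1])
  moreover have "T \<inter> ?Q = {}" using T by fastforce
  ultimately obtain a b where ab: "a \<noteq> 0" "\<forall>x\<in>T. inner a x \<le> b" "\<forall>x\<in>?Q. inner a x \<ge> b"
    using separating_hyperplane_sets[of T ?Q] assms by auto
  obtain \<alpha> \<beta> where a: "a = (\<alpha>, \<beta>)" by force
  have Q: "b \<le> \<alpha> * x + \<beta> * y" if "x > 0" "y > 0" for x y
    using ab(3) that by (auto simp: a)
  \<comment> \<open>An affine function bounded below on the positive axis cannot have negative
    slope: the chosen point \<open>s\<close> would push it below \<open>d\<close>. It is applied to
    each coordinate of the normal with the other variable fixed at 1.\<close>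
  have lim: "0 \<le> c" if "\<And>s. s > 0 \<Longrightarrow> d \<le> c * s + e * 1" for c d e :: real
  proof (rule ccontr)
    assume "\<not> 0 \<le> c"
    hence "c < 0" by simp
    have "d \<le> c * ((\<bar>d\<bar> + \<bar>e\<bar> + 1) / (- c)) + e * 1"
      using \<open>c < 0\<close> by (intro that divide_pos_pos) auto
    also have "\<dots> = - (\<bar>d\<bar> + \<bar>e\<bar> + 1) + e" using \<open>c < 0\<close> by (simp add: field_simps)
    finally show False by linarith
  qed
  have "0 \<le> \<alpha>" by (rule lim) (use Q[of _ 1] in auto)
  moreover have "0 \<le> \<beta>" by (rule lim) (use Q[of 1] in \<open>auto simp: add.commute\<close>)
  moreover have "b \<le> 0"
  proof (rule field_le_epsilon)
    fix e :: real assume "e > 0"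
    \<comment> \<open>The point of the quadrant with both coordinates \<open>e\<close> / (|\<alpha>|
      + |\<beta>| + 1) gives a value of at most \<open>e\<close>; the added 1 keeps the denominator
      positive.\<close>
    have "b \<le> \<alpha> * (e / (\<bar>\<alpha>\<bar> + \<bar>\<beta>\<bar> + 1)) + \<beta> * (e / (\<bar>\<alpha>\<bar> + \<bar>\<beta>\<bar> + 1))"
      by (rule Q) (use \<open>e > 0\<close> in \<open>auto intro!: divide_pos_pos add_nonneg_pos\<close>)
    also have "\<dots> = e * ((\<alpha> + \<beta>) / (\<bar>\<alpha>\<bar> + \<bar>\<beta>\<bar> + 1))" by (simp add: add_divide_distrib algebra_simps)
    also have "\<dots> \<le> e * 1"
      by (rule mult_left_mono) (use \<open>e > 0\<close> in \<open>auto simp: divide_le_eq_1\<close>)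
    finally show "b \<le> 0 + e" by simp
  qed
  moreover have "\<alpha> + \<beta> > 0" using \<open>0 \<le> \<alpha>\<close> \<open>0 \<le> \<beta>\<close> ab(1) by (auto simp: a zero_prod_def)
  moreover have "\<alpha> * x + \<beta> * y \<le> 0" if "(x, y) \<in> T" for x y
    using ab(2) that \<open>b \<le> 0\<close> by (fastforce simp: a)
  ultimately show thesis
    by (intro that[of "\<alpha> / (\<alpha> + \<beta>)" "\<beta> / (\<alpha> + \<beta>)"])
      (auto simp: add_divide_distrib[symmetric] divide_le_0_iff)
qed

text \<open>Stated for an arbitrary index set \<open>S\<close> of directions whose image is convex, so that sequences
  of state and control variations need not form a Euclidean space. In the induction, the
  constraint \<open>j\<close> is traded against the combination found for the directions with \<open>l j s > 0\<close>.\<close>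

lemma gordan_alternative:
  fixes l :: "'i \<Rightarrow> 's \<Rightarrow> real"
  assumes "finite I" "S \<noteq> {}"
    and "\<And>s s' \<theta>. s \<in> S \<Longrightarrow> s' \<in> S \<Longrightarrow> 0 \<le> \<theta> \<Longrightarrow> \<theta> \<le> 1 \<Longrightarrow>
           \<exists>s''\<in>S. \<forall>i\<in>I. l i s'' = (1 - \<theta>) * l i s + \<theta> * l i s'"
    and "\<And>s. s \<in> S \<Longrightarrow> \<exists>i\<in>I. l i s \<le> 0"
  shows "\<exists>\<nu>. (\<forall>i\<in>I. 0 \<le> \<nu> i) \<and> sum \<nu> I = 1 \<and> (\<forall>s\<in>S. (\<Sum>i\<in>I. \<nu> i * l i s) \<le> 0)"
  using assms
proof (induction I arbitrary: S rule: finite_induct)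
  case empty
  then show ?case by auto
next
  case (insert j I)
  define S' where "S' = {s \<in> S. l j s > 0}"
  show ?case
  \<comment> \<open>If no direction makes \<open>l j\<close> positive, all weight goes to
    \<open>j\<close>. Otherwise the induction hypothesis is applied to \<open>S'\<close> instead of
    \<open>S\<close>.\<close>
  proof (cases "S' = {}")
    case True
    then have "\<forall>s\<in>S. l j s \<le> 0" by (auto simp: S'_def not_less)
    then show ?thesis using insert.hyps
      by (intro exI[of _ "\<lambda>i. if i = j then 1 else 0"]) (auto simp: if_distrib[of "\<lambda>c. c * _"] cong: if_cong)
  next
    case False
    have conv: "\<exists>s''\<in>S'. \<forall>i\<in>I. l i s'' = (1 - \<theta>) * l i s + \<theta> * l i s'"
      if "s \<in> S'" "s' \<in> S'" "0 \<le> \<theta>" "\<theta> \<le> 1" for s s' \<theta>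
    proof -
      obtain s'' where s'': "s'' \<in> S" "\<forall>i\<in>insert j I. l i s'' = (1 - \<theta>) * l i s + \<theta> * l i s'"
        using insert.prems(2)[of s s' \<theta>] \<open>s \<in> S'\<close> \<open>s' \<in> S'\<close> \<open>0 \<le> \<theta>\<close> \<open>\<theta> \<le> 1\<close>
        by (auto simp: S'_def)
      have "l j s'' > 0"
      proof (cases "\<theta> = 0")
        case True
        then show ?thesis using s'' that by (simp add: S'_def)
      next
        case False
        then have "(1 - \<theta>) * l j s + \<theta> * l j s' > 0"
          using that by (intro add_nonneg_pos) (auto simp: S'_def)
        then show ?thesis using s'' by simp
      qed
      then show ?thesis using s'' by (auto simp: S'_def)
    qed
    have neg: "\<exists>i\<in>I. l i s \<le> 0" if "s \<in> S'" for s
      using insert.prems(3)[of s] that by (auto simp: S'_def)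
    obtain \<nu> where \<nu>: "\<forall>i\<in>I. 0 \<le> \<nu> i" "sum \<nu> I = 1" "\<forall>s\<in>S'. (\<Sum>i\<in>I. \<nu> i * l i s) \<le> 0"
      using insert.IH[OF False conv neg] by auto
    define L where "L = (\<lambda>s. \<Sum>i\<in>I. \<nu> i * l i s)"
    define T where "T = (\<lambda>s. (L s, l j s)) ` S"
    \<comment> \<open>The planar image of \<open>S\<close> under the pair of \<open>L\<close> and
      \<open>l j\<close> avoids the open quadrant, since \<open>L\<close> is nonpositive wherever
      \<open>l j\<close> is positive. Separation there yields the relative weight of
      \<open>j\<close> against the combination \<nu>.\<close>
    have "convex T"
      unfolding convex_alt
    proof (intro ballI allI impI)
      fix z z' \<theta> assume "z \<in> T" "z' \<in> T" and \<theta>: "0 \<le> \<theta> \<and> \<theta> \<le> (1::real)"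
      then obtain s s' where s: "s \<in> S" "s' \<in> S" and z: "z = (L s, l j s)" "z' = (L s', l j s')"
        by (auto simp: T_def)
      obtain s'' where s'': "s'' \<in> S" "\<forall>i\<in>insert j I. l i s'' = (1 - \<theta>) * l i s + \<theta> * l i s'"
        using insert.prems(2)[of s s' \<theta>] s \<theta> by auto
      have "L s'' = (1 - \<theta>) * L s + \<theta> * L s'"
        unfolding L_def sum_distrib_left sum.distrib[symmetric]
      proof (rule sum.cong)
        fix i assume "i \<in> I"
        then have "l i s'' = (1 - \<theta>) * l i s + \<theta> * l i s'" using s'' by simp
        then show "\<nu> i * l i s'' = (1 - \<theta>) * (\<nu> i * l i s) + \<theta> * (\<nu> i * l i s')"
          by (simp only:) (simp add: algebra_simps)
      qed simp
      then have "(1 - \<theta>) *\<^sub>R z + \<theta> *\<^sub>R z' = (L s'', l j s'')"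
        using s'' by (simp add: z)
      then show "(1 - \<theta>) *\<^sub>R z + \<theta> *\<^sub>R z' \<in> T" using s'' by (auto simp: T_def)
    qed
    moreover have "T \<noteq> {}" using insert.prems by (auto simp: T_def)
    moreover have "x \<le> 0 \<or> y \<le> 0" if "(x, y) \<in> T" for x y
      using that \<nu>(3) by (auto simp: T_def S'_def L_def not_less)
    ultimately obtain \<alpha> \<beta> where ab: "\<alpha> \<ge> 0" "\<beta> \<ge> 0" "\<alpha> + \<beta> = 1"
      "\<And>x y. (x, y) \<in> T \<Longrightarrow> \<alpha> * x + \<beta> * y \<le> 0"
      using separate_open_quadrant by blast
    define \<nu>' where "\<nu>' = (\<lambda>i. if i = j then \<beta> else \<alpha> * \<nu> i)"
    have *: "(\<Sum>i\<in>insert j I. \<nu>' i * c i) = \<beta> * c j + \<alpha> * (\<Sum>i\<in>I. \<nu> i * c i)" for c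
    proof -
      have "(\<Sum>i\<in>I. \<nu>' i * c i) = (\<Sum>i\<in>I. \<alpha> * (\<nu> i * c i))"
        by (rule sum.cong) (use insert.hyps in \<open>auto simp: \<nu>'_def\<close>)
      then show ?thesis using insert.hyps by (simp add: \<nu>'_def sum_distrib_left)
    qed
    have "sum \<nu>' (insert j I) = 1" using *[of "\<lambda>_. 1"] \<nu>(2) ab by simp
    moreover have "\<forall>i\<in>insert j I. 0 \<le> \<nu>' i" using \<nu> ab by (auto simp: \<nu>'_def)
    moreover have "\<forall>s\<in>S. (\<Sum>i\<in>insert j I. \<nu>' i * l i s) \<le> 0"
      unfolding * using ab(4) by (force simp: T_def L_def add.commute)
    ultimately show ?thesis by blast
  qed
qed

section \<open>Alternatives for bounded linear functionals\<close>

lemma blinfun_nonpos_imp_0: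
  fixes B :: "'a::real_normed_vector \<Rightarrow>\<^sub>L real"
  assumes "\<And>w. B w \<le> 0"
  shows "B = 0"
proof (rule blinfun_eqI)
  fix w show "B w = blinfun_apply 0 w"
    using assms[of w] assms[of "- w"] by (simp add: blinfun.minus_right)
qed

lemma convex_combination_neq_0:
  fixes G :: "'k \<Rightarrow> 'v::real_vector"
  assumes "finite I" "0 \<notin> convex hull (G ` I)" "\<And>k. k \<in> I \<Longrightarrow> 0 \<le> c k" "sum c I = 1"
  shows "(\<Sum>k\<in>I. c k *\<^sub>R G k) \<noteq> 0"
proof -
  have "(\<Sum>k\<in>I. c k *\<^sub>R G k) \<in> convex hull (G ` I)"
    using assms by (intro convex_sum) (auto intro: hull_inc)
  then show ?thesis using assms(2) by auto
qed

text \<open>Otherwise Gordan gives a convex combination of the \<open>G k\<close> that is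
  nonpositive everywhere, hence zero, against the hull condition. Under (v) this makes the cone of
  strictly feasible control directions nonempty.\<close>

lemma common_positive_direction:
  fixes G :: "'k \<Rightarrow> ('a::real_normed_vector \<Rightarrow>\<^sub>L real)"
  assumes "finite I" "0 \<notin> convex hull (G ` I)"
  shows "\<exists>w. \<forall>k\<in>I. G k w > 0"
proof (rule ccontr)
  assume "\<not> ?thesis"
  then have neg: "\<exists>k\<in>I. blinfun_apply (G k) w \<le> 0" for w by (auto simp: not_less)
  have conv: "\<exists>s''\<in>UNIV. \<forall>k\<in>I. blinfun_apply (G k) s'' = (1 - \<theta>) * blinfun_apply (G k) s
      + \<theta> * blinfun_apply (G k) s'" for s s' \<theta>
    by (intro bexI[of _ "(1 - \<theta>) *\<^sub>R s + \<theta> *\<^sub>R s'"])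
      (simp_all add: blinfun.add_right blinfun.scaleR_right)
  obtain \<nu> where \<nu>: "\<forall>k\<in>I. 0 \<le> \<nu> k" "sum \<nu> I = 1" "\<And>w. (\<Sum>k\<in>I. \<nu> k * G k w) \<le> 0"
    using gordan_alternative[of I UNIV "\<lambda>k. blinfun_apply (G k)", OF assms(1) _ conv neg] by auto
  have "(\<Sum>k\<in>I. \<nu> k *\<^sub>R G k) = 0"
    by (rule blinfun_nonpos_imp_0) (use \<nu>(3) in \<open>simp add: blinfun.sum_left blinfun.scaleR_left\<close>)
  then show False using convex_combination_neq_0[OF assms, of \<nu>] \<nu> by auto
qed

text \<open>Gordan is applied to \<open>q\<close> (index \<open>None\<close>) together with the
  \<open>G k\<close> (index \<open>Some k\<close>). The weight of \<open>q\<close> cannot vanish,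
  since the remaining weights would then put 0 into the hull; dividing by it gives the
  multipliers.\<close>

lemma farkas_multipliers:
  fixes G :: "'k \<Rightarrow> ('a::real_normed_vector \<Rightarrow>\<^sub>L real)"
  assumes fin: "finite I" and hull: "0 \<notin> convex hull (G ` I)"
    and q: "\<And>w. (\<forall>k\<in>I. G k w > 0) \<Longrightarrow> blinfun_apply q w \<le> 0"
  shows "\<exists>\<mu>. (\<forall>k\<in>I. 0 \<le> \<mu> k) \<and> q + (\<Sum>k\<in>I. \<mu> k *\<^sub>R G k) = 0"
proof -
  let ?l = "\<lambda>i w. case i of None \<Rightarrow> blinfun_apply q w | Some k \<Rightarrow> blinfun_apply (G k) w"
  let ?I = "insert None (Some ` I)"
  have neg: "\<exists>i\<in>?I. ?l i w \<le> 0" for w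
    using q[of w] by (force simp: not_less)
  have conv: "\<exists>s''\<in>UNIV. \<forall>i\<in>?I. ?l i s'' = (1 - \<theta>) * ?l i s + \<theta> * ?l i s'" for s s' \<theta>
    by (intro bexI[of _ "(1 - \<theta>) *\<^sub>R s + \<theta> *\<^sub>R s'"])
      (simp_all add: blinfun.add_right blinfun.scaleR_right)
  obtain \<nu> where \<nu>: "\<forall>i\<in>?I. 0 \<le> \<nu> i" "sum \<nu> ?I = 1" "\<And>w. (\<Sum>i\<in>?I. \<nu> i * ?l i w) \<le> 0"
    using gordan_alternative[of ?I UNIV ?l, OF _ _ conv neg] fin by auto
  have sum: "(\<Sum>i\<in>?I. h i) = h None + (\<Sum>k\<in>I. h (Some k))" for h :: "'k option \<Rightarrow> 'z::comm_monoid_add"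
    using fin by (simp add: sum.reindex)
  have 0: "\<nu> None *\<^sub>R q + (\<Sum>k\<in>I. \<nu> (Some k) *\<^sub>R G k) = 0"
    by (rule blinfun_nonpos_imp_0)
      (use \<nu>(3) in \<open>simp add: sum blinfun.add_left blinfun.sum_left blinfun.scaleR_left\<close>)
  have "\<nu> None \<noteq> 0"
  proof
    assume "\<nu> None = 0"
    then show False
      using convex_combination_neq_0[OF fin hull, of "\<lambda>k. \<nu> (Some k)"] 0 \<nu> by (auto simp: sum)
  qed
  then have pos: "\<nu> None > 0" using \<nu>(1) by (simp add: less_le)
  have "q + (\<Sum>k\<in>I. (\<nu> (Some k) / \<nu> None) *\<^sub>R G k)
      = (1 / \<nu> None) *\<^sub>R (\<nu> None *\<^sub>R q + (\<Sum>k\<in>I. \<nu> (Some k) *\<^sub>R G k))"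
    using pos by (simp add: scaleR_add_right scaleR_sum_right)
  then show ?thesis
    using 0 \<nu>(1) pos by (intro exI[of _ "\<lambda>k. \<nu> (Some k) / \<nu> None"]) auto
qed

section \<open>Gateaux derivatives\<close>

text \<open>A direction that stays in \<open>A\<close> for small positive steps makes the right-hand
  filter finer than the one in the definition. All later perturbations use positive steps
  only.\<close>

lemma has_gateaux_derivative_at_right:
  assumes D: "has_gateaux_derivative \<Phi> D A a"
    and ev: "\<forall>\<^sub>F s in at_right 0. a + s *\<^sub>R v \<in> A"
  shows "((\<lambda>s. (1 / s) *\<^sub>R (\<Phi> (a + s *\<^sub>R v) - \<Phi> a)) \<longlongrightarrow> blinfun_apply D v) (at_right 0)"
proof (rule tendsto_mono)
  show "((\<lambda>s. (1 / s) *\<^sub>R (\<Phi> (a + s *\<^sub>R v) - \<Phi> a)) \<longlongrightarrow> blinfun_apply D v)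
          (at 0 within {s. a + s *\<^sub>R v \<in> A})"
    using D by (simp add: has_gateaux_derivative_def)
  show "at_right 0 \<le> at (0::real) within {s. a + s *\<^sub>R v \<in> A}"
  proof (rule filter_leI)
    fix P assume "eventually P (at (0::real) within {s. a + s *\<^sub>R v \<in> A})"
    then show "eventually P (at_right 0)"
      using ev unfolding eventually_at_filter by eventually_elim auto
  qed
qed

text \<open>Every vector \<open>v\<close> is a rescaled difference of two points \<open>w\<close>
  and \<open>w + s v\<close> of the open set, so linearity carries the equality over.\<close>

lemma blinfun_eq_if_eq_on_open:
  fixes D D' :: "'a::real_normed_vector \<Rightarrow>\<^sub>L 'b::real_normed_vector"
  assumes "open W" "W \<noteq> {}" and eq: "\<And>w. w \<in> W \<Longrightarrow> blinfun_apply D w = blinfun_apply D' w"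
  shows "D = D'"
proof (rule blinfun_eqI)
  fix v
  obtain w where w: "w \<in> W" using assms by auto
  have "((\<lambda>s::real. w + s *\<^sub>R v) \<longlongrightarrow> w + 0 *\<^sub>R v) (at_right 0)" by (intro tendsto_intros)
  then have "\<forall>\<^sub>F s in at_right (0::real). w + s *\<^sub>R v \<in> W"
    using topological_tendstoD[OF _ \<open>open W\<close>] w by fastforce
  moreover have "\<forall>\<^sub>F s in at_right (0::real). s > 0" by (simp add: eventually_at_right_less)
  ultimately have "\<forall>\<^sub>F s in at_right (0::real). s > 0 \<and> w + s *\<^sub>R v \<in> W"
    by eventually_elim auto
  then obtain s :: real where s: "s > 0" "w + s *\<^sub>R v \<in> W"
    using eventually_happens'[OF trivial_limit_at_right_real] by blast
  have "blinfun_apply D (w + s *\<^sub>R v) = blinfun_apply D' (w + s *\<^sub>R v)" by (rule eq) (rule s)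
  then show "blinfun_apply D v = blinfun_apply D' v"
    using eq[OF w] s(1) by (simp add: blinfun.add_right blinfun.scaleR_right)
qed

text \<open>The definite description in \<open>DG\<close> needs uniqueness. Two derivatives agree
  along every direction entering \<open>A\<close>, and an open set of such directions determines a
  linear map.\<close>

lemma DG_eqI:
  assumes D: "has_gateaux_derivative \<Phi> D A a" and W: "open W" "W \<noteq> {}"
    and ev: "\<And>w. w \<in> W \<Longrightarrow> \<forall>\<^sub>F s in at_right 0. a + s *\<^sub>R w \<in> A"
  shows "DG \<Phi> A a = D"
  unfolding DG_def
proof (rule the_equality)
  fix D' assume D': "has_gateaux_derivative \<Phi> D' A a"
  show "D' = D"
  proof (rule blinfun_eq_if_eq_on_open[OF W])
    fix w assume "w \<in> W"
    from has_gateaux_derivative_at_right[OF D' ev[OF this]]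
      has_gateaux_derivative_at_right[OF D ev[OF this]]
    show "blinfun_apply D' w = blinfun_apply D w"
      by (rule tendsto_unique[rotated]) simp
  qed
qed (rule D)

lemma eventually_add_scaleR_in_open:
  fixes a :: "'a::real_normed_vector"
  assumes "open X" "a \<in> X"
  shows "\<forall>\<^sub>F s in at_right (0::real). a + s *\<^sub>R v \<in> X"
proof -
  have "((\<lambda>s::real. a + s *\<^sub>R v) \<longlongrightarrow> a + 0 *\<^sub>R v) (at_right 0)" by (intro tendsto_intros)
  then show ?thesis using topological_tendstoD[of _ "a + 0 *\<^sub>R v" _ X] assms by fastforce
qed

lemma has_gateaux_derivative_DG_UNIV:
  assumes "gateaux_differentiable \<Phi> UNIV a"
  shows "has_gateaux_derivative \<Phi> (DG \<Phi> UNIV a) UNIV a"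
proof -
  obtain D where "has_gateaux_derivative \<Phi> D UNIV a"
    using assms by (auto simp: gateaux_differentiable_def)
  moreover from this have "DG \<Phi> UNIV a = D" by (rule DG_eqI[of _ _ _ _ UNIV]) auto
  ultimately show ?thesis by simp
qed

text \<open>The joint derivative composed with the embedding of the first factor is a partial
  derivative; openness of \<open>X\<close> allows every direction, so it is the only one.\<close>

lemma DG1_apply:
  assumes D: "has_gateaux_derivative \<Phi> D (X \<times> U) (x, u)" and "open X" "x \<in> X" "u \<in> U"
  shows "blinfun_apply (DG1 \<Phi> (X \<times> U) (x, u)) y = blinfun_apply D (y, 0)"
proof -
  let ?E = "Blinfun (\<lambda>y. (y, 0))"
  have E: "blinfun_apply ?E y = (y, 0)" for y
    by (subst bounded_linear_Blinfun_apply)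
      (auto intro!: bounded_linear_Pair bounded_linear_ident bounded_linear_zero)
  have "has_gateaux_derivative (\<lambda>y. \<Phi> (y, u)) (D o\<^sub>L ?E) {y. (y, u) \<in> X \<times> U} x"
    unfolding has_gateaux_derivative_def
  proof
    fix v
    show "((\<lambda>s. (1 / s) *\<^sub>R (\<Phi> (x + s *\<^sub>R v, u) - \<Phi> (x, u))) \<longlongrightarrow> blinfun_apply (D o\<^sub>L ?E) v)
       (at 0 within {s. x + s *\<^sub>R v \<in> {y. (y, u) \<in> X \<times> U}})"
      using D[unfolded has_gateaux_derivative_def, rule_format, of "(v, 0)"] by (simp add: E)
  qed
  then have "DG (\<lambda>y. \<Phi> (y, u)) {y. (y, u) \<in> X \<times> U} x = D o\<^sub>L ?E"
    by (rule DG_eqI[of _ _ _ _ UNIV])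
      (use assms(2-4) eventually_add_scaleR_in_open[of X x] in auto)
  then show ?thesis by (simp add: DG1_def E)
qed

text \<open>As for \<open>DG1_apply\<close>, but \<open>U\<close> need not contain a neighbourhood
  of \<open>u\<close>. Uniqueness rests on an open set \<open>W\<close> of directions along which
  \<open>U\<close> is not left immediately.\<close>

lemma DG2_apply:
  assumes D: "has_gateaux_derivative \<Phi> D (X \<times> U) (x, u)" and "x \<in> X"
    and W: "open W" "W \<noteq> {}" "\<And>w. w \<in> W \<Longrightarrow> \<forall>\<^sub>F s in at_right 0. u + s *\<^sub>R w \<in> U"
  shows "blinfun_apply (DG2 \<Phi> (X \<times> U) (x, u)) w = blinfun_apply D (0, w)"
proof -
  let ?E = "Blinfun (\<lambda>w. (0, w))"
  have E: "blinfun_apply ?E w = (0, w)" for w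
    by (subst bounded_linear_Blinfun_apply)
      (auto intro!: bounded_linear_Pair bounded_linear_ident bounded_linear_zero)
  have "has_gateaux_derivative (\<lambda>w. \<Phi> (x, w)) (D o\<^sub>L ?E) {w. (x, w) \<in> X \<times> U} u"
    unfolding has_gateaux_derivative_def
  proof
    fix v
    show "((\<lambda>s. (1 / s) *\<^sub>R (\<Phi> (x, u + s *\<^sub>R v) - \<Phi> (x, u))) \<longlongrightarrow> blinfun_apply (D o\<^sub>L ?E) v)
       (at 0 within {s. u + s *\<^sub>R v \<in> {w. (x, w) \<in> X \<times> U}})"
      using D[unfolded has_gateaux_derivative_def, rule_format, of "(0, v)"] by (simp add: E)
  qed
  then have "DG (\<lambda>w. \<Phi> (x, w)) {w. (x, w) \<in> X \<times> U} u = D o\<^sub>L ?E"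
    by (rule DG_eqI[OF _ W(1,2)]) (use assms(2) W(3) in auto)
  then show ?thesis by (simp add: DG2_def E)
qed

lemma eventually_positive_along:
  fixes g :: "'a::euclidean_space \<Rightarrow> real"
  assumes "has_gateaux_derivative g G UNIV u" "g u = 0" "blinfun_apply G w > 0"
  shows "\<forall>\<^sub>F s in at_right (0::real). g (u + s *\<^sub>R w) \<ge> 0"
proof -
  have "((\<lambda>s. (1 / s) *\<^sub>R (g (u + s *\<^sub>R w) - g u)) \<longlongrightarrow> blinfun_apply G w) (at_right 0)"
    by (rule has_gateaux_derivative_at_right[OF assms(1)]) simp
  then have "\<forall>\<^sub>F s in at_right 0. (1 / s) *\<^sub>R (g (u + s *\<^sub>R w) - g u) > 0"
    using assms(3) by (rule order_tendstoD)
  moreover have "\<forall>\<^sub>F s in at_right (0::real). s > 0" by (simp add: eventually_at_right_less)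
  ultimately show ?thesis
    by eventually_elim (use assms(2) in \<open>simp add: zero_less_divide_iff\<close>)
qed

lemma lsc_at_eventually_along:
  fixes \<Phi> :: "'a::real_normed_vector \<Rightarrow> real"
  assumes "lsc_at \<Phi> A a" "c < \<Phi> a" "\<forall>\<^sub>F s in at_right 0. a + s *\<^sub>R v \<in> A"
  shows "\<forall>\<^sub>F s in at_right (0::real). c < \<Phi> (a + s *\<^sub>R v)"
proof -
  \<comment> \<open>Semicontinuity speaks of punctured neighbourhoods; \<open>a\<close> itself is
    added because \<open>c\<close> < \<Phi> \<open>a\<close>. This covers \<open>v\<close> = 0,
    where the path never leaves \<open>a\<close>.\<close>
  have "\<forall>\<^sub>F y in nhds a. y \<in> A \<longrightarrow> c < \<Phi> y"
    using assms(1,2) unfolding lsc_at_def eventually_at_filter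
    by (smt (verit, best) eventually_mono)
  moreover have "((\<lambda>s::real. a + s *\<^sub>R v) \<longlongrightarrow> a + 0 *\<^sub>R v) (at_right 0)"
    by (intro tendsto_intros)
  ultimately have "\<forall>\<^sub>F s in at_right (0::real). a + s *\<^sub>R v \<in> A \<longrightarrow> c < \<Phi> (a + s *\<^sub>R v)"
    using eventually_compose_filterlim by fastforce
  with assms(3) show ?thesis by eventually_elim auto
qed

section \<open>Multipliers up to a finite horizon\<close>

lemma compact_nested_closed:
  fixes C :: "nat \<Rightarrow> 'a::topological_space set"
  assumes "compact K" and closed: "\<And>h. closed (C h)" and "decseq C"
    and ne: "\<And>h. K \<inter> C h \<noteq> {}"
  shows "\<exists>z\<in>K. \<forall>h. z \<in> C h"
proof -
  have "K \<inter> (\<Inter>h\<in>UNIV. C h) \<noteq> {}"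
  proof (rule compact_imp_fip_image[OF \<open>compact K\<close>])
    fix I :: "nat set" assume "finite I"
    \<comment> \<open>Nestedness reduces a finite intersection to its last set; inserting 0 keeps
      \<open>Max\<close> meaningful for empty \<open>I\<close>.\<close>
    then have "C (Max (insert 0 I)) \<subseteq> C h" if "h \<in> I" for h
      using that by (intro decseqD[OF \<open>decseq C\<close>]) auto
    then show "K \<inter> (\<Inter>h\<in>I. C h) \<noteq> {}" using ne[of "Max (insert 0 I)"] by blast
  qed (use closed in auto)
  then show ?thesis by auto
qed

lemma compact_PiE_UNIV:
  fixes B :: "'i \<Rightarrow> 'a::topological_space set"
  assumes "\<And>i. compact (B i)"
  shows "compact (Pi\<^sub>E UNIV B)"
proof -
  have "compactin (product_topology (\<lambda>i. euclidean) UNIV) (Pi\<^sub>E UNIV B)"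
    unfolding compactin_PiE using assms by simp
  then show ?thesis by (simp add: euclidean_product_topology)
qed

text \<open>The adjoint vector \<open>p\<close> is represented by the vector of its coordinates, and the maximum
  condition is kept as an inequality on the cone \<open>W t\<close> of feasible control directions, so that
  the multipliers of the constraints on the control need not be carried to the limit.\<close>

definition multipliers_upto ::
  "(nat \<Rightarrow> ((real^'n) \<times> (real^'d)) \<Rightarrow>\<^sub>L (real^'n)) \<Rightarrow> (nat \<Rightarrow> ((real^'n) \<times> (real^'d)) \<Rightarrow>\<^sub>L real) \<Rightarrow>
   (nat \<Rightarrow> (real^'d) set) \<Rightarrow> (nat \<Rightarrow> 'n \<Rightarrow> bool) \<Rightarrow> nat \<Rightarrow> (real \<times> (nat \<Rightarrow> real^'n)) set" where
  "multipliers_upto F \<Psi> W act h =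
     {(l, p). 0 \<le> l \<and> (\<forall>t\<le>h. \<forall>\<alpha>. 0 \<le> p (Suc t) $ \<alpha>) \<and>
        (\<forall>t\<le>h. \<forall>\<alpha>. \<not> act t \<alpha> \<longrightarrow> p (Suc t) $ \<alpha> = 0) \<and>
        (\<forall>t\<in>{1..h}. \<forall>y. p t \<bullet> y = p (Suc t) \<bullet> blinfun_apply (F t) (y, 0) + l * blinfun_apply (\<Psi> t) (y, 0)) \<and>
        (\<forall>t\<le>h. \<forall>w\<in>W t. p (Suc t) \<bullet> blinfun_apply (F t) (0, w) + l * blinfun_apply (\<Psi> t) (0, w) \<le> 0)}"

text \<open>Every clause is a weak inequality or an equation between continuous functions of
  \<open>l\<close> and finitely many coordinates of \<open>p\<close>, and coordinates are continuous
  in the product topology.\<close>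

lemma closed_multipliers_upto: "closed (multipliers_upto F \<Psi> W act h)"
proof -
  have [continuous_intros]: "continuous_on A (\<lambda>z. snd z t)"
    for A :: "(real \<times> (nat \<Rightarrow> real^'n)) set" and t
    by (rule continuous_on_compose2[OF continuous_on_product_coordinates[of t]])
      (auto intro: continuous_intros)
  have closed_imp: "closed {z. Q \<longrightarrow> R z}" if "closed {z. R z}" for Q R
    using that by (cases Q) auto
  have "multipliers_upto F \<Psi> W act h =
     {z. 0 \<le> fst z \<and> (\<forall>t. t \<le> h \<longrightarrow> (\<forall>\<alpha>. 0 \<le> snd z (Suc t) $ \<alpha>)) \<and>
        (\<forall>t. t \<le> h \<longrightarrow> (\<forall>\<alpha>. \<not> act t \<alpha> \<longrightarrow> snd z (Suc t) $ \<alpha> = 0)) \<and>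
        (\<forall>t. t \<in> {1..h} \<longrightarrow> (\<forall>y. snd z t \<bullet> y = snd z (Suc t) \<bullet> blinfun_apply (F t) (y, 0) + fst z * blinfun_apply (\<Psi> t) (y, 0))) \<and>
        (\<forall>t. t \<le> h \<longrightarrow> (\<forall>w. w \<in> W t \<longrightarrow> snd z (Suc t) \<bullet> blinfun_apply (F t) (0, w) + fst z * blinfun_apply (\<Psi> t) (0, w) \<le> 0))}"
    by (auto simp: multipliers_upto_def)
  also have "closed \<dots>"
    by (intro closed_Collect_conj closed_Collect_all closed_imp closed_Collect_le closed_Collect_eq
        continuous_intros)
  finally show ?thesis .
qed

lemma multipliers_upto_mono:
  "h \<le> h' \<Longrightarrow> multipliers_upto F \<Psi> W act h' \<subseteq> multipliers_upto F \<Psi> W act h"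
  by (auto simp: multipliers_upto_def)

text \<open>The hypothesis is what (vi) and (vii) have in common: pairing \<open>p' \<ge> 0\<close> with \<open>L z\<close> dominates
  a coordinate of \<open>p'\<close>.\<close>

lemma norm_adjoint_le:
  fixes L :: "real^'n \<Rightarrow> real^'n" and a :: "real^'n \<Rightarrow> real"
  assumes "\<And>\<alpha>. \<exists>z. axis \<alpha> 1 \<le> L z"
  shows "\<exists>K\<ge>0. \<forall>l p p'. 0 \<le> l \<longrightarrow> (\<forall>\<alpha>. 0 \<le> p' $ \<alpha>) \<longrightarrow> (\<forall>y. p \<bullet> y = p' \<bullet> L y + l * a y)
           \<longrightarrow> norm p' \<le> K * (l + norm p)"
proof -
  obtain z where z: "\<And>\<alpha>. axis \<alpha> 1 \<le> L (z \<alpha>)" using assms by metis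
  define K where "K = (\<Sum>\<alpha>\<in>UNIV. norm (z \<alpha>) + \<bar>a (z \<alpha>)\<bar>)"
  have "norm p' \<le> K * (l + norm p)"
    if l: "0 \<le> l" and p': "\<forall>\<alpha>. 0 \<le> p' $ \<alpha>" and eq: "\<forall>y. p \<bullet> y = p' \<bullet> L y + l * a y" for l p p'
  proof -
    have "\<bar>p' $ \<alpha>\<bar> \<le> (norm (z \<alpha>) + \<bar>a (z \<alpha>)\<bar>) * (l + norm p)" for \<alpha>
    proof -
      have "\<bar>p' $ \<alpha>\<bar> = p' \<bullet> axis \<alpha> 1" using p' by (simp add: inner_axis)
      also have "\<dots> \<le> p' \<bullet> L (z \<alpha>)"
        unfolding inner_vec_def
        by (rule sum_mono) (use z[of \<alpha>] p' in \<open>auto simp: less_eq_vec_def intro: mult_left_mono\<close>)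
      also have "\<dots> = p \<bullet> z \<alpha> - l * a (z \<alpha>)" using eq by simp
      also have "\<dots> \<le> norm p * norm (z \<alpha>) + l * \<bar>a (z \<alpha>)\<bar>"
      proof -
        have "- (l * a (z \<alpha>)) \<le> l * \<bar>a (z \<alpha>)\<bar>"
          using mult_left_mono[OF abs_ge_minus_self[of "a (z \<alpha>)"] l] by simp
        then show ?thesis using norm_cauchy_schwarz[of p "z \<alpha>"] by linarith
      qed
      also have "\<dots> \<le> (norm (z \<alpha>) + \<bar>a (z \<alpha>)\<bar>) * (l + norm p)"
        using l by (simp add: algebra_simps)
      finally show ?thesis .
    qed
    then have "(\<Sum>\<alpha>\<in>UNIV. \<bar>p' $ \<alpha>\<bar>) \<le> K * (l + norm p)"
      unfolding K_def sum_distrib_right by (intro sum_mono)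
    then show ?thesis using norm_le_l1_cart[of p'] by linarith
  qed
  moreover have "K \<ge> 0" unfolding K_def by (intro sum_nonneg) auto
  ultimately show ?thesis by blast
qed

text \<open>The constant depends on the time \<open>t\<close> but not on the horizon
  \<open>h\<close>. It is propagated forward, one adjoint equation per step, by
  \<open>norm_adjoint_le\<close>.\<close>

lemma norm_multipliers_upto_le:
  assumes "\<And>t \<alpha>. t \<ge> 1 \<Longrightarrow> \<exists>z. axis \<alpha> 1 \<le> blinfun_apply (F t) (z, 0)"
  shows "\<exists>C\<ge>0. \<forall>h l p. t \<le> h \<longrightarrow> (l, p) \<in> multipliers_upto F \<Psi> W act h
           \<longrightarrow> norm (p (Suc t)) \<le> C * (l + norm (p 1))"
proof (induction t)
  case 0
  show ?case by (rule exI[of _ 1]) (auto simp: multipliers_upto_def)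
next
  case (Suc t)
  then obtain C where C: "C \<ge> 0" "\<And>h l p. t \<le> h \<Longrightarrow> (l, p) \<in> multipliers_upto F \<Psi> W act h
    \<Longrightarrow> norm (p (Suc t)) \<le> C * (l + norm (p 1))" by blast
  obtain K where K: "K \<ge> 0" "\<And>l p p'. 0 \<le> l \<Longrightarrow> \<forall>\<alpha>. 0 \<le> p' $ \<alpha> \<Longrightarrow>
      \<forall>y. p \<bullet> y = p' \<bullet> blinfun_apply (F (Suc t)) (y, 0) + l * blinfun_apply (\<Psi> (Suc t)) (y, 0) \<Longrightarrow>
      norm p' \<le> K * (l + norm p)"
    using norm_adjoint_le[of "\<lambda>y. blinfun_apply (F (Suc t)) (y, 0)" "\<lambda>y. blinfun_apply (\<Psi> (Suc t)) (y, 0)"]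
      assms[of "Suc t"] by (simp add: Bex_def) blast
  have "norm (p (Suc (Suc t))) \<le> K * (1 + C) * (l + norm (p 1))"
    if "Suc t \<le> h" and M: "(l, p) \<in> multipliers_upto F \<Psi> W act h" for h l p
  proof -
    have l: "0 \<le> l" using M by (simp add: multipliers_upto_def)
    have "norm (p (Suc (Suc t))) \<le> K * (l + norm (p (Suc t)))"
      using that by (intro K) (auto simp: multipliers_upto_def)
    also have "\<dots> \<le> K * (l + C * (l + norm (p 1)))"
      using C(2)[OF _ M] that K(1) by (intro mult_left_mono) auto
    also have "\<dots> \<le> K * ((l + norm (p 1)) + C * (l + norm (p 1)))"
      using K(1) by (intro mult_left_mono) auto
    finally show ?thesis by (simp add: algebra_simps)
  qed
  then show ?case using C(1) K(1) by (intro exI[of _ "K * (1 + C)"]) auto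
qed

text \<open>By the uniform bounds, nontrivial multipliers have positive
  \<open>l + norm (p 1)\<close> and can be scaled to make it 1. The normalised ones meet a single
  compact product in nested closed nonempty sets.\<close>

lemma multipliers_all_horizons:
  fixes F :: "nat \<Rightarrow> ((real^'n) \<times> (real^'d)) \<Rightarrow>\<^sub>L (real^'n)"
  assumes A: "\<And>t \<alpha>. t \<ge> 1 \<Longrightarrow> \<exists>z. axis \<alpha> 1 \<le> blinfun_apply (F t) (z, 0)"
    and ex: "\<And>h. \<exists>(l, p) \<in> multipliers_upto F \<Psi> W act h. l \<noteq> 0 \<or> (\<exists>t\<le>h. p (Suc t) \<noteq> 0)"
  shows "\<exists>l p. l + norm (p 1) = 1 \<and> (\<forall>h. (l, p) \<in> multipliers_upto F \<Psi> W act h)"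
proof -
  let ?M = "multipliers_upto F \<Psi> W act"
  define Q where "Q = (\<lambda>t C. C \<ge> 0 \<and> (\<forall>h l p. t \<le> h \<longrightarrow> (l, p) \<in> ?M h
      \<longrightarrow> norm (p (Suc t)) \<le> C * (l + norm (p 1))))"
  have "\<forall>t. \<exists>C. Q t C" unfolding Q_def using norm_multipliers_upto_le[where F = F, OF A] by blast
  then obtain C where "\<forall>t. Q t (C t)" by metis
  then have C: "\<And>t. C t \<ge> 0" "\<And>t h l p. t \<le> h \<Longrightarrow> (l, p) \<in> ?M h
      \<Longrightarrow> norm (p (Suc t)) \<le> C t * (l + norm (p 1))"
    by (auto simp: Q_def)
  define N where "N = {z :: real \<times> (nat \<Rightarrow> real^'n). fst z + norm (snd z 1) = 1}"
  \<comment> \<open>The radius is shifted because \<open>C t\<close> bounds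
    \<open>p (Suc t)\<close>; for index 0, truncated subtraction gives \<open>C 0\<close>.\<close>
  define K where "K = {0..1::real} \<times> Pi\<^sub>E UNIV (\<lambda>t. cball (0::real^'n) (C (t - 1)))"
  have "continuous_on UNIV (\<lambda>z :: real \<times> (nat \<Rightarrow> real^'n). snd z 1)"
    by (rule continuous_on_compose2[OF continuous_on_product_coordinates[of 1]])
      (auto intro: continuous_intros)
  then have "closed N" unfolding N_def by (intro closed_Collect_eq continuous_intros)
  have "\<exists>z\<in>K. \<forall>h. z \<in> ?M h \<inter> N"
  proof (rule compact_nested_closed)
    show "compact K" unfolding K_def by (intro compact_Times compact_PiE_UNIV) auto
    show "closed (?M h \<inter> N)" for h by (intro closed_Int closed_multipliers_upto \<open>closed N\<close>)
    show "decseq (\<lambda>h. ?M h \<inter> N)" unfolding decseq_def using multipliers_upto_mono by blast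
    fix h
    obtain l p where lp: "(l, p) \<in> ?M h" "l \<noteq> 0 \<or> (\<exists>t\<le>h. p (Suc t) \<noteq> 0)" using ex by blast
    have l: "l \<ge> 0" using lp by (simp add: multipliers_upto_def)
    have "l + norm (p 1) \<noteq> 0"
    proof
      assume 0: "l + norm (p 1) = 0"
      then have "l = 0" using l norm_ge_zero[of "p 1"] by linarith
      then obtain t where "t \<le> h" "p (Suc t) \<noteq> 0" using lp by auto
      then show False using C(2)[OF _ lp(1)] 0 by fastforce
    qed
    then have c: "l + norm (p 1) > 0" using l by (simp add: add_nonneg_eq_0_iff less_le)
    define c where "c = 1 / (l + norm (p 1))"
    have c0: "c > 0" and c1: "c * (l + norm (p 1)) = 1" using c by (simp_all add: c_def)
    \<comment> \<open>Membership up to horizon \<open>h\<close> only involves the indices from 1 to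
      \<open>Suc h\<close>. Setting all other entries to 0 preserves it and brings the sequence into
      \<open>K\<close>.\<close>
    define q where "q = (\<lambda>t. if t \<in> {1..Suc h} then c *\<^sub>R p t else 0)"
    have M: "(c * l, q) \<in> ?M h"
      using lp(1) c0 l unfolding multipliers_upto_def
      by (auto simp: q_def distrib_left[symmetric] mult_le_0_iff mult.assoc)
    have q1: "c * l + norm (q 1) = 1" using c0 c1 by (simp add: q_def distrib_left)
    have "(c * l, q) \<in> K"
    proof -
      have "norm (q t) \<le> C (t - 1)" for t
      proof (cases "t \<in> {1..Suc h}")
        case True
        then have "norm (q (Suc (t - 1))) \<le> C (t - 1) * (c * l + norm (q 1))"
          by (intro C(2)[OF _ M]) auto
        then show ?thesis using True q1 by simp
      next
        case False
        then show ?thesis using C(1) by (auto simp: q_def)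
      qed
      moreover have "c * l \<le> 1" using q1 norm_ge_zero[of "q 1"] by linarith
      ultimately show ?thesis using c0 l by (auto simp: K_def)
    qed
    then show "K \<inter> (?M h \<inter> N) \<noteq> {}" using M q1 by (auto simp: N_def)
  qed
  then show ?thesis by (force simp: N_def)
qed

text \<open>Gordan's alternative is applied to pairs of state and control variations: index
  \<open>None\<close> is the linearised cost, and \<open>Some (t, \<alpha>)\<close> is an active
  coordinate of the dynamics. Variations concentrated at a single time then isolate the adjoint
  equation and the maximum condition.\<close>

lemma multipliers_upto_exist:
  fixes F :: "nat \<Rightarrow> ((real^'n) \<times> (real^'d)) \<Rightarrow>\<^sub>L (real^'n)"
  assumes W: "\<And>t. convex (W t)" "\<And>t. 0 \<in> W t"
    and no_improvement: "\<And>y w. y 0 = 0 \<Longrightarrow> (\<And>t. t > h \<Longrightarrow> y t = 0) \<Longrightarrow> (\<And>t. w t \<in> W t) \<Longrightarrow>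
        (\<And>t \<alpha>. t \<le> h \<Longrightarrow> act t \<alpha> \<Longrightarrow> (blinfun_apply (F t) (y t, w t) - y (Suc t)) $ \<alpha> > 0) \<Longrightarrow>
        (\<Sum>t\<le>h. blinfun_apply (\<Psi> t) (y t, w t)) \<le> 0"
  shows "\<exists>(l, p) \<in> multipliers_upto F \<Psi> W act h. l \<noteq> 0 \<or> (\<exists>t\<le>h. p (Suc t) \<noteq> 0)"
proof -
  define S where "S = {s :: (nat \<Rightarrow> real^'n) \<times> (nat \<Rightarrow> real^'d).
    fst s 0 = 0 \<and> (\<forall>t>h. fst s t = 0) \<and> (\<forall>t. snd s t \<in> W t)}"
  define R where "R = {(t, \<alpha>). t \<le> h \<and> act t \<alpha>}"
  define res where "res = (\<lambda>(s :: (nat \<Rightarrow> real^'n) \<times> (nat \<Rightarrow> real^'d)) t.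
    blinfun_apply (F t) (fst s t, snd s t) - fst s (Suc t))"
  define cost where "cost = (\<lambda>(s :: (nat \<Rightarrow> real^'n) \<times> (nat \<Rightarrow> real^'d)).
    \<Sum>t\<le>h. blinfun_apply (\<Psi> t) (fst s t, snd s t))"
  define ell where "ell = (\<lambda>i s. case i of None \<Rightarrow> cost s | Some (t, \<alpha>) \<Rightarrow> res s t $ \<alpha>)"
  let ?I = "insert None (Some ` R)"
  have "R \<subseteq> {..h} \<times> UNIV" by (auto simp: R_def)
  then have finR: "finite R" by (rule finite_subset) auto
  have sum_I: "(\<Sum>i\<in>?I. c i) = c None + (\<Sum>r\<in>R. c (Some r))" for c :: "_ \<Rightarrow> real"
    using finR by (simp add: sum.reindex)
  have comb: "\<exists>s''\<in>S. \<forall>i\<in>?I. ell i s'' = (1 - \<theta>) * ell i s + \<theta> * ell i s'"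
    if s: "s \<in> S" "s' \<in> S" and \<theta>: "0 \<le> \<theta>" "\<theta> \<le> 1" for s s' \<theta>
  proof -
    define s'' where "s'' = (\<lambda>t. (1 - \<theta>) *\<^sub>R fst s t + \<theta> *\<^sub>R fst s' t, \<lambda>t. (1 - \<theta>) *\<^sub>R snd s t + \<theta> *\<^sub>R snd s' t)"
    have pair: "(fst s'' t, snd s'' t) = (1 - \<theta>) *\<^sub>R (fst s t, snd s t) + \<theta> *\<^sub>R (fst s' t, snd s' t)" for t
      by (simp add: s''_def)
    have "s'' \<in> S"
      using s \<theta> W(1) by (auto simp: S_def s''_def convex_alt)
    moreover have "res s'' t = (1 - \<theta>) *\<^sub>R res s t + \<theta> *\<^sub>R res s' t" for t
      unfolding res_def pair blinfun.add_right blinfun.scaleR_right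
      by (simp add: s''_def scaleR_diff_right)
    moreover have "cost s'' = (1 - \<theta>) * cost s + \<theta> * cost s'"
      unfolding cost_def pair blinfun.add_right blinfun.scaleR_right
      by (simp add: sum.distrib sum_distrib_left)
    ultimately show ?thesis by (intro bexI[of _ s'']) (auto simp: ell_def)
  qed
  have "(\<lambda>_. 0, \<lambda>_. 0) \<in> S" using W(2) by (auto simp: S_def)
  then have "S \<noteq> {}" by auto
  moreover have "\<exists>i\<in>?I. ell i s \<le> 0" if s: "s \<in> S" for s
  proof (cases "\<exists>r\<in>R. ell (Some r) s \<le> 0")
    case False
    then have pos: "ell (Some r) s > 0" if "r \<in> R" for r using that by (auto simp: not_le)
    have "(\<Sum>t\<le>h. blinfun_apply (\<Psi> t) (fst s t, snd s t)) \<le> 0"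
    proof (rule no_improvement)
      show "(blinfun_apply (F t) (fst s t, snd s t) - fst s (Suc t)) $ \<alpha> > 0"
        if "t \<le> h" "act t \<alpha>" for t \<alpha>
        using pos[of "(t, \<alpha>)"] that by (simp add: R_def ell_def res_def)
    qed (use s in \<open>auto simp: S_def\<close>)
    then show ?thesis by (simp add: ell_def cost_def)
  qed auto
  ultimately obtain \<nu> where \<nu>: "\<forall>i\<in>?I. 0 \<le> \<nu> i" "sum \<nu> ?I = 1"
      "\<forall>s\<in>S. (\<Sum>i\<in>?I. \<nu> i * ell i s) \<le> 0"
    using gordan_alternative[of ?I S ell, OF _ _ comb] finR by auto
  define l where "l = \<nu> None"
  \<comment> \<open>The constraint at time \<open>t\<close> produces the vector at time
    \<open>Suc t\<close>, hence the shift. Inactive coordinates receive 0, which is complementary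
    slackness.\<close>
  define p where "p = (\<lambda>t. \<chi> \<alpha>. if t \<ge> 1 \<and> (t - 1, \<alpha>) \<in> R then \<nu> (Some (t - 1, \<alpha>)) else 0)"
  have p_Suc: "p (Suc t) $ \<alpha> = (if (t, \<alpha>) \<in> R then \<nu> (Some (t, \<alpha>)) else 0)" for t \<alpha>
    by (simp add: p_def)
  have ineq: "l * cost s + (\<Sum>t\<le>h. p (Suc t) \<bullet> res s t) \<le> 0" if "s \<in> S" for s
  proof -
    have "(\<Sum>t\<le>h. p (Suc t) \<bullet> res s t) = (\<Sum>(t, \<alpha>)\<in>{..h} \<times> UNIV. p (Suc t) $ \<alpha> * res s t $ \<alpha>)"
      by (simp add: inner_vec_def sum.cartesian_product)
    also have "\<dots> = (\<Sum>(t, \<alpha>)\<in>R. p (Suc t) $ \<alpha> * res s t $ \<alpha>)"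
      by (rule sum.mono_neutral_right) (use \<open>R \<subseteq> _\<close> in \<open>auto simp: p_Suc\<close>)
    also have "\<dots> = (\<Sum>r\<in>R. \<nu> (Some r) * ell (Some r) s)"
      by (rule sum.cong) (auto simp: p_Suc ell_def)
    finally show ?thesis
      using \<nu>(3) that by (simp add: sum_I l_def ell_def)
  qed
  have adj: "p \<tau> \<bullet> v = p (Suc \<tau>) \<bullet> blinfun_apply (F \<tau>) (v, 0) + l * blinfun_apply (\<Psi> \<tau>) (v, 0)"
    if \<tau>: "\<tau> \<in> {1..h}" for \<tau> v
  proof -
    have le: "l * blinfun_apply (\<Psi> \<tau>) (v, 0) + (p (Suc \<tau>) \<bullet> blinfun_apply (F \<tau>) (v, 0) - p \<tau> \<bullet> v) \<le> 0" for v
    proof -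
      \<comment> \<open>A state impulse at \<tau> changes two residuals: through \<open>F\<close> at
        \<tau>, and through the subtracted next state at \<tau> - 1. It lies in \<open>S\<close>
        because 1 \<le> \<tau> \<le> \<open>h\<close>.\<close>
      define s :: "(nat \<Rightarrow> real^'n) \<times> (nat \<Rightarrow> real^'d)"
        where "s = (\<lambda>t. if t = \<tau> then v else 0, \<lambda>_. 0)"
      have "s \<in> S" using \<tau> W(2) by (auto simp: S_def s_def)
      have "cost s = (\<Sum>t\<le>h. if t = \<tau> then blinfun_apply (\<Psi> \<tau>) (v, 0) else 0)"
        unfolding cost_def s_def by (rule sum.cong) (auto simp: zero_prod_def[symmetric])
      also have "\<dots> = blinfun_apply (\<Psi> \<tau>) (v, 0)" using \<tau> by simp
      finally have 1: "cost s = blinfun_apply (\<Psi> \<tau>) (v, 0)" .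
      have "(\<Sum>t\<le>h. p (Suc t) \<bullet> res s t) =
        (\<Sum>t\<le>h. (if t = \<tau> then p (Suc \<tau>) \<bullet> blinfun_apply (F \<tau>) (v, 0) else 0) - (if t = \<tau> - 1 then p \<tau> \<bullet> v else 0))"
        unfolding res_def s_def
        by (rule sum.cong) (use \<tau> in \<open>auto simp: zero_prod_def[symmetric] inner_diff_right\<close>)
      also have "\<dots> = p (Suc \<tau>) \<bullet> blinfun_apply (F \<tau>) (v, 0) - p \<tau> \<bullet> v"
        using \<tau> by (auto simp: sum_subtractf)
      finally show ?thesis using ineq[OF \<open>s \<in> S\<close>] 1 by simp
    qed
    show ?thesis
      \<comment> \<open>State variations are unrestricted in sign, so the inequality becomes an
        equation. Control variations range over a cone only, and \<open>max\<close> stays an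
        inequality.\<close>
      using le[of v] le[of "- v"] blinfun.minus_right[of "F \<tau>" "(v, 0)"]
        blinfun.minus_right[of "\<Psi> \<tau>" "(v, 0)"] by simp
  qed
  have max: "p (Suc \<tau>) \<bullet> blinfun_apply (F \<tau>) (0, w) + l * blinfun_apply (\<Psi> \<tau>) (0, w) \<le> 0"
    if \<tau>: "\<tau> \<le> h" and "w \<in> W \<tau>" for \<tau> w
  proof -
    define s :: "(nat \<Rightarrow> real^'n) \<times> (nat \<Rightarrow> real^'d)"
      where "s = (\<lambda>_. 0, \<lambda>t. if t = \<tau> then w else 0)"
    have "s \<in> S" using W(2) that by (auto simp: S_def s_def)
    have "cost s = (\<Sum>t\<le>h. if t = \<tau> then blinfun_apply (\<Psi> \<tau>) (0, w) else 0)"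
      unfolding cost_def s_def by (rule sum.cong) (auto simp: zero_prod_def[symmetric])
    moreover have "(\<Sum>t\<le>h. p (Suc t) \<bullet> res s t) =
      (\<Sum>t\<le>h. if t = \<tau> then p (Suc \<tau>) \<bullet> blinfun_apply (F \<tau>) (0, w) else 0)"
      unfolding res_def s_def by (rule sum.cong) (auto simp: zero_prod_def[symmetric])
    ultimately show ?thesis using ineq[OF \<open>s \<in> S\<close>] \<tau> by simp
  qed
  have "l \<ge> 0" using \<nu> by (simp add: l_def)
  moreover have "\<forall>t\<le>h. \<forall>\<alpha>. 0 \<le> p (Suc t) $ \<alpha>" using \<nu>(1) by (simp add: p_Suc)
  moreover have "\<forall>t\<le>h. \<forall>\<alpha>. \<not> act t \<alpha> \<longrightarrow> p (Suc t) $ \<alpha> = 0" by (simp add: p_Suc R_def)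
  ultimately have "(l, p) \<in> multipliers_upto F \<Psi> W act h"
    using adj max by (simp add: multipliers_upto_def)
  moreover have "l \<noteq> 0 \<or> (\<exists>t\<le>h. p (Suc t) \<noteq> 0)"
  proof (rule ccontr)
    assume "\<not> ?thesis"
    then have 0: "l = 0" "\<And>t. t \<le> h \<Longrightarrow> p (Suc t) = 0" by auto
    have "\<nu> (Some r) = 0" if "r \<in> R" for r
    proof -
      obtain t \<alpha> where r: "r = (t, \<alpha>)" by force
      then have "p (Suc t) $ \<alpha> = 0" using 0(2)[of t] that by (auto simp: R_def)
      then show ?thesis using p_Suc[of t \<alpha>] that r by simp
    qed
    then have "sum \<nu> ?I = 0" using 0 by (simp add: sum_I l_def)
    then show False using \<nu>(2) by simp
  qed
  ultimately show ?thesis by blast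
qed

section \<open>Perturbations of an optimal process\<close>

text \<open>Two processes that agree after \<open>h\<close> differ by a finite sum. For the first
  problem the tails of the series cancel; for the second the differences are eventually constant, so
  the limsup is that constant; the third reduces to the second by liminf \<le> limsup.\<close>

lemma solution_not_improvable:
  assumes sol: "solves_P1 X U f \<phi> \<sigma> xh uh \<or> solves_P2 X U f \<phi> \<sigma> xh uh \<or>
              solves_P3 X U f \<phi> \<sigma> xh uh"
    and adm: "(x, u) \<in> Adm X U f \<sigma>" and tail: "\<And>t. t > h \<Longrightarrow> x t = xh t \<and> u t = uh t"
  shows "(\<Sum>t\<le>h. \<phi> t (x t, u t)) \<le> (\<Sum>t\<le>h. \<phi> t (xh t, uh t))"
proof -
  define a where "a = (\<lambda>t. \<phi> t (x t, u t))"
  define b where "b = (\<lambda>t. \<phi> t (xh t, uh t))"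
  have ab: "a t = b t" if "t > h" for t using tail[OF that] by (simp add: a_def b_def)
  have *: "sum a {..h} \<le> sum b {..h}"
    if lim: "limsup (\<lambda>k. ereal ((\<Sum>t=0..k. b t) - (\<Sum>t=0..k. a t))) \<ge> 0"
  proof -
    have "(\<Sum>t=0..k. b t) - (\<Sum>t=0..k. a t) = sum b {..h} - sum a {..h}" if "k \<ge> h" for k
      unfolding sum_subtractf[symmetric]
      by (rule sum.mono_neutral_right) (use that ab in auto)
    then have "\<forall>\<^sub>F k in sequentially. ereal ((\<Sum>t=0..k. b t) - (\<Sum>t=0..k. a t))
        = ereal (sum b {..h} - sum a {..h})"
      by (auto intro!: eventually_sequentiallyI[of h])
    then have "limsup (\<lambda>k. ereal ((\<Sum>t=0..k. b t) - (\<Sum>t=0..k. a t)))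
        = limsup (\<lambda>k::nat. ereal (sum b {..h} - sum a {..h}))"
      by (rule Limsup_eq)
    then show ?thesis using lim by (simp add: Limsup_const)
  qed
  consider "solves_P1 X U f \<phi> \<sigma> xh uh" | "solves_P2 X U f \<phi> \<sigma> xh uh" | "solves_P3 X U f \<phi> \<sigma> xh uh"
    using sol by blast
  then have "sum a {..h} \<le> sum b {..h}"
  proof cases
    case 1
    then have b: "summable b" by (auto simp: solves_P1_def Dom_def b_def)
    have "summable a \<longleftrightarrow> summable b"
      by (rule summable_cong) (use ab in \<open>auto intro!: eventually_sequentiallyI[of "Suc h"]\<close>)
    with b have a: "summable a" by simp
    then have "(x, u) \<in> Dom X U f \<phi> \<sigma>" using adm by (simp add: Dom_def a_def)
    then have "suminf a \<le> suminf b" using 1 by (auto simp: solves_P1_def J_def a_def b_def)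
    moreover have "suminf a = (\<Sum>t. a (t + Suc h)) + sum a {..h}"
      using suminf_split_initial_segment[OF a, of "Suc h"] by (simp add: lessThan_Suc_atMost)
    moreover have "suminf b = (\<Sum>t. b (t + Suc h)) + sum b {..h}"
      using suminf_split_initial_segment[OF b, of "Suc h"] by (simp add: lessThan_Suc_atMost)
    moreover have "(\<Sum>t. a (t + Suc h)) = (\<Sum>t. b (t + Suc h))"
      by (rule suminf_cong) (simp add: ab)
    ultimately show ?thesis by simp
  next
    case 2
    then show ?thesis using adm by (intro *) (auto simp: solves_P2_def a_def b_def)
  next
    case 3
    then have "liminf (\<lambda>k. ereal ((\<Sum>t=0..k. b t) - (\<Sum>t=0..k. a t))) \<ge> 0"
      using adm by (auto simp: solves_P3_def a_def b_def)
    also have "liminf (\<lambda>k. ereal ((\<Sum>t=0..k. b t) - (\<Sum>t=0..k. a t)))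
        \<le> limsup (\<lambda>k. ereal ((\<Sum>t=0..k. b t) - (\<Sum>t=0..k. a t)))"
      by (rule Liminf_le_Limsup) simp
    finally show ?thesis by (rule *)
  qed
  then show ?thesis by (simp add: a_def b_def)
qed

lemma solution_in_Adm:
  assumes "solves_P1 X U f \<phi> \<sigma> xh uh \<or> solves_P2 X U f \<phi> \<sigma> xh uh \<or> solves_P3 X U f \<phi> \<sigma> xh uh"
  shows "(xh, uh) \<in> Adm X U f \<sigma>"
  using assms by (auto simp: solves_P1_def solves_P2_def solves_P3_def Dom_def)

text \<open>Active constraints become positive to first order, inactive ones remain positive by
  semicontinuity, and there are finitely many of them.\<close>

lemma feasible_control_direction:
  fixes g :: "nat \<Rightarrow> 'a::euclidean_space \<Rightarrow> real"
  assumes u: "\<And>k. k \<in> {1..m} \<Longrightarrow> g k u \<ge> 0"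
    and diff: "\<And>k. k \<in> {1..m} \<Longrightarrow> gateaux_differentiable (g k) UNIV u"
    and lsc: "\<And>k. k \<in> {1..m} \<Longrightarrow> g k u > 0 \<Longrightarrow> lsc_at (g k) UNIV u"
    and w: "\<And>k. k \<in> {1..m} \<Longrightarrow> g k u = 0 \<Longrightarrow> blinfun_apply (DG (g k) UNIV u) w > 0"
  shows "\<forall>\<^sub>F s in at_right (0::real). u + s *\<^sub>R w \<in> (\<Inter>k\<in>{1..m}. {u. g k u \<ge> 0})"
proof -
  have "\<forall>\<^sub>F s in at_right (0::real). g k (u + s *\<^sub>R w) \<ge> 0" if k: "k \<in> {1..m}" for k
  proof (cases "g k u = 0")
    case True
    show ?thesis
      by (rule eventually_positive_along[OF has_gateaux_derivative_DG_UNIV[OF diff[OF k]] True w[OF k True]])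
  next
    case False
    then have pos: "g k u > 0" using u[OF k] by simp
    have "\<forall>\<^sub>F s in at_right (0::real). 0 < g k (u + s *\<^sub>R w)"
      by (rule lsc_at_eventually_along[OF lsc[OF k pos] pos]) simp
    then show ?thesis by eventually_elim simp
  qed
  then have "\<forall>\<^sub>F s in at_right (0::real). \<forall>k\<in>{1..m}. g k (u + s *\<^sub>R w) \<ge> 0"
    by (intro eventually_ball_finite) auto
  then show ?thesis by eventually_elim auto
qed

lemma no_first_order_improvement:
  fixes X :: "nat \<Rightarrow> (real^'n) set" and U :: "nat \<Rightarrow> (real^'d) set"
  assumes X: "\<And>t. open (X t)"
    and sol: "solves_P1 X U f \<phi> \<sigma> xh uh \<or> solves_P2 X U f \<phi> \<sigma> xh uh \<or>
              solves_P3 X U f \<phi> \<sigma> xh uh"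
    and F: "\<And>t. has_gateaux_derivative (f t) (F t) (X t \<times> U t) (xh t, uh t)"
    and \<Psi>: "\<And>t. has_gateaux_derivative (\<phi> t) (\<Psi> t) (X t \<times> U t) (xh t, uh t)"
    and lsc: "\<And>t \<alpha>. f t (xh t, uh t) $ \<alpha> > xh (Suc t) $ \<alpha> \<Longrightarrow>
                lsc_at (\<lambda>z. f t z $ \<alpha>) (X t \<times> U t) (xh t, uh t)"
    and w: "\<And>t. \<forall>\<^sub>F s in at_right 0. uh t + s *\<^sub>R w t \<in> U t"
    and y0: "y 0 = 0" and yh: "\<And>t. t > h \<Longrightarrow> y t = 0"
    and act: "\<And>t \<alpha>. t \<le> h \<Longrightarrow> f t (xh t, uh t) $ \<alpha> = xh (Suc t) $ \<alpha> \<Longrightarrow>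
               (blinfun_apply (F t) (y t, w t) - y (Suc t)) $ \<alpha> > 0"
  shows "(\<Sum>t\<le>h. blinfun_apply (\<Psi> t) (y t, w t)) \<le> 0"
proof (rule ccontr)
  assume "\<not> ?thesis"
  then have cost: "(\<Sum>t\<le>h. blinfun_apply (\<Psi> t) (y t, w t)) > 0" by simp
  have adm: "\<And>t. xh t \<in> X t" "\<And>t. uh t \<in> U t" "xh 0 = \<sigma>" "\<And>t. xh (Suc t) \<le> f t (xh t, uh t)"
    using solution_in_Adm[OF sol] by (auto simp: Adm_def)
  have path: "\<forall>\<^sub>F s in at_right 0. (xh t, uh t) + s *\<^sub>R (y t, w t) \<in> X t \<times> U t" for t
    using w[of t] eventually_add_scaleR_in_open[OF X adm(1), of t "y t"]
    by eventually_elim auto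
  have pos: "\<forall>\<^sub>F s in at_right (0::real). s > 0" by (simp add: eventually_at_right_less)
  have state: "\<forall>\<^sub>F s in at_right 0. (xh (Suc t) + s *\<^sub>R y (Suc t)) $ \<alpha>
       \<le> f t ((xh t, uh t) + s *\<^sub>R (y t, w t)) $ \<alpha>" if t: "t \<le> h" for t \<alpha>
  proof (cases "f t (xh t, uh t) $ \<alpha> = xh (Suc t) $ \<alpha>")
    case True
    have "((\<lambda>s. ((1 / s) *\<^sub>R (f t ((xh t, uh t) + s *\<^sub>R (y t, w t)) - f t (xh t, uh t))) $ \<alpha>)
        \<longlongrightarrow> blinfun_apply (F t) (y t, w t) $ \<alpha>) (at_right 0)"
      by (intro tendsto_vec_nth has_gateaux_derivative_at_right[OF F path])
    then have "\<forall>\<^sub>F s in at_right 0.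
        y (Suc t) $ \<alpha> < ((1 / s) *\<^sub>R (f t ((xh t, uh t) + s *\<^sub>R (y t, w t)) - f t (xh t, uh t))) $ \<alpha>"
      using act[OF t True] by (intro order_tendstoD) auto
    then show ?thesis using pos
      by eventually_elim (use True in \<open>simp add: pos_less_divide_eq mult.commute\<close>)
  next
    case False
    then have less: "xh (Suc t) $ \<alpha> < f t (xh t, uh t) $ \<alpha>"
      using adm(4)[of t] by (simp add: less_eq_vec_def less_le)
    then obtain c where c: "xh (Suc t) $ \<alpha> < c" "c < f t (xh t, uh t) $ \<alpha>" using dense by blast
    have "((\<lambda>s. (xh (Suc t) + s *\<^sub>R y (Suc t)) $ \<alpha>) \<longlongrightarrow> (xh (Suc t) + 0 *\<^sub>R y (Suc t)) $ \<alpha>) (at_right 0)"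
      by (intro tendsto_intros)
    then have "\<forall>\<^sub>F s in at_right 0. (xh (Suc t) + s *\<^sub>R y (Suc t)) $ \<alpha> < c"
      using c(1) by (intro order_tendstoD) auto
    moreover have "\<forall>\<^sub>F s in at_right 0. c < f t ((xh t, uh t) + s *\<^sub>R (y t, w t)) $ \<alpha>"
      by (rule lsc_at_eventually_along[OF lsc[OF less] c(2) path])
    ultimately show ?thesis by eventually_elim simp
  qed
  have "((\<lambda>s. \<Sum>t\<le>h. (1 / s) *\<^sub>R (\<phi> t ((xh t, uh t) + s *\<^sub>R (y t, w t)) - \<phi> t (xh t, uh t)))
      \<longlongrightarrow> (\<Sum>t\<le>h. blinfun_apply (\<Psi> t) (y t, w t))) (at_right 0)"
    by (intro tendsto_sum has_gateaux_derivative_at_right[OF \<Psi> path])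
  then have improve: "\<forall>\<^sub>F s in at_right 0.
      0 < (\<Sum>t\<le>h. (1 / s) *\<^sub>R (\<phi> t ((xh t, uh t) + s *\<^sub>R (y t, w t)) - \<phi> t (xh t, uh t)))"
    using cost by (intro order_tendstoD)
  have "\<forall>\<^sub>F s in at_right 0. \<forall>t\<in>{..h}. (xh t, uh t) + s *\<^sub>R (y t, w t) \<in> X t \<times> U t"
    using path by (intro eventually_ball_finite) auto
  moreover have "\<forall>\<^sub>F s in at_right 0. \<forall>t\<in>{..h}. \<forall>\<alpha>. (xh (Suc t) + s *\<^sub>R y (Suc t)) $ \<alpha>
       \<le> f t ((xh t, uh t) + s *\<^sub>R (y t, w t)) $ \<alpha>"
    using state by (intro eventually_ball_finite ballI eventually_all_finite) auto
  ultimately have "\<forall>\<^sub>F s in at_right 0. s > 0 \<and>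
      (\<forall>t\<in>{..h}. (xh t, uh t) + s *\<^sub>R (y t, w t) \<in> X t \<times> U t) \<and>
      (\<forall>t\<in>{..h}. \<forall>\<alpha>. (xh (Suc t) + s *\<^sub>R y (Suc t)) $ \<alpha>
         \<le> f t ((xh t, uh t) + s *\<^sub>R (y t, w t)) $ \<alpha>) \<and>
      0 < (\<Sum>t\<le>h. (1 / s) *\<^sub>R (\<phi> t ((xh t, uh t) + s *\<^sub>R (y t, w t)) - \<phi> t (xh t, uh t)))"
    (is "\<forall>\<^sub>F s in _. ?good s")
    using pos improve by eventually_elim blast
  from eventually_happens'[OF trivial_limit_at_right_real this]
  obtain s where "?good s" by (rule exE)
  then have s: "s > 0"
      "\<And>t. t \<le> h \<Longrightarrow> (xh t, uh t) + s *\<^sub>R (y t, w t) \<in> X t \<times> U t"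
      "\<And>t \<alpha>. t \<le> h \<Longrightarrow> (xh (Suc t) + s *\<^sub>R y (Suc t)) $ \<alpha>
         \<le> f t ((xh t, uh t) + s *\<^sub>R (y t, w t)) $ \<alpha>"
      "0 < (\<Sum>t\<le>h. (1 / s) *\<^sub>R (\<phi> t ((xh t, uh t) + s *\<^sub>R (y t, w t)) - \<phi> t (xh t, uh t)))"
    by (simp_all only: atMost_iff Ball_def)
  define x where "x = (\<lambda>t. xh t + s *\<^sub>R y t)"
  \<comment> \<open>\<open>y\<close> vanishes after \<open>h\<close> but \<open>w\<close> need not,
    so the control variation is cut off explicitly. The state at \<open>Suc h\<close> is the
    original one, and the process continues unchanged from there.\<close>
  define u where "u = (\<lambda>t. if t \<le> h then uh t + s *\<^sub>R w t else uh t)"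
  have x_tail: "x t = xh t" if "t > h" for t using yh[OF that] by (simp add: x_def)
  have "x t \<in> X t \<and> u t \<in> U t" for t
    by (cases "t \<le> h") (use s(2)[of t] adm x_tail[of t] in \<open>auto simp: x_def u_def\<close>)
  moreover have "x (Suc t) \<le> f t (x t, u t)" for t
  proof (cases "t \<le> h")
    case True
    then show ?thesis using s(3) by (simp add: x_def u_def less_eq_vec_def)
  next
    case False
    then show ?thesis using x_tail[of t] x_tail[of "Suc t"] adm(4)[of t] by (simp add: u_def)
  qed
  moreover have "x 0 = \<sigma>" using adm(3) y0 by (simp add: x_def)
  ultimately have "(x, u) \<in> Adm X U f \<sigma>" by (simp add: Adm_def)
  then have "(\<Sum>t\<le>h. \<phi> t (x t, u t)) \<le> (\<Sum>t\<le>h. \<phi> t (xh t, uh t))"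
    by (rule solution_not_improvable[OF sol]) (use x_tail in \<open>auto simp: u_def\<close>)
  moreover have "(\<Sum>t\<le>h. (1 / s) *\<^sub>R (\<phi> t ((xh t, uh t) + s *\<^sub>R (y t, w t)) - \<phi> t (xh t, uh t)))
      = (1 / s) * ((\<Sum>t\<le>h. \<phi> t (x t, u t)) - (\<Sum>t\<le>h. \<phi> t (xh t, uh t)))"
    unfolding sum_subtractf[symmetric] sum_distrib_left
    by (rule sum.cong) (auto simp: x_def u_def)
  ultimately show False using s(1,4) by (simp add: zero_less_mult_iff zero_less_divide_iff)
qed

section \<open>From the conditions on the state derivative to the theorem\<close>

lemma axis_le_if_invertible_or_pos_diag:
  fixes L :: "real^'n \<Rightarrow> real^'n"
  assumes "linear L"
    and "invertible (matrix L) \<or>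
         (\<forall>\<alpha> \<beta>. matrix L $ \<alpha> $ \<beta> \<ge> 0) \<and> (\<forall>\<alpha>. matrix L $ \<alpha> $ \<alpha> > 0)"
  shows "\<exists>z. axis \<alpha> 1 \<le> L z"
  using assms(2)
proof
  assume "invertible (matrix L)"
  then obtain B where B: "matrix L ** B = mat 1" unfolding invertible_def by blast
  \<comment> \<open>Under invertibility \<open>z\<close> is the preimage of the axis vector, and
    equality holds.\<close>
  have "L (B *v axis \<alpha> 1) = matrix L *v (B *v axis \<alpha> 1)"
    by (simp add: matrix_works assms(1))
  also have "\<dots> = axis \<alpha> 1" by (simp add: matrix_vector_mul_assoc B)
  finally show ?thesis by (intro exI[of _ "B *v axis \<alpha> 1"]) simp
next
  assume *: "(\<forall>\<alpha> \<beta>. matrix L $ \<alpha> $ \<beta> \<ge> 0) \<and> (\<forall>\<alpha>. matrix L $ \<alpha> $ \<alpha> > 0)"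
  \<comment> \<open>Dividing the axis vector by the diagonal entry makes coordinate \<alpha> of the
    image equal to 1; the other coordinates are nonnegative.\<close>
  define d where "d = matrix L $ \<alpha> $ \<alpha>"
  have d: "d > 0" using * by (simp add: d_def)
  have "(axis \<alpha> 1 :: real^'n) $ \<beta> \<le> L ((1 / d) *\<^sub>R axis \<alpha> 1) $ \<beta>" for \<beta>
  proof -
    have "L ((1 / d) *\<^sub>R axis \<alpha> 1) $ \<beta> = matrix L $ \<beta> $ \<alpha> / d"
      by (simp add: linear_scale[OF assms(1)] matrix_def)
    then show ?thesis
      by (cases "\<beta> = \<alpha>") (use * d in \<open>simp_all add: axis_def flip: d_def\<close>)
  qed
  then show ?thesis by (intro exI[of _ "(1 / d) *\<^sub>R axis \<alpha> 1"]) (simp add: less_eq_vec_def)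
qed

theorem theorem4p3:
  fixes X :: "nat \<Rightarrow> (real^'n) set"
    and U :: "nat \<Rightarrow> (real^'d) set"
    and f :: "nat \<Rightarrow> (real^'n) \<times> (real^'d) \<Rightarrow> real^'n"
    and \<phi> :: "nat \<Rightarrow> (real^'n) \<times> (real^'d) \<Rightarrow> real"
    and \<sigma> :: "real^'n"
    and m :: nat
    and g :: "nat \<Rightarrow> nat \<Rightarrow> real^'d \<Rightarrow> real"
    and xh :: "nat \<Rightarrow> real^'n"
    and uh :: "nat \<Rightarrow> real^'d"
  assumes X: "\<And>t. open (X t)" "\<And>t. X t \<noteq> {}"
    and U: "\<And>t. U t \<noteq> {}" "\<And>t. U t = (\<Inter>k\<in>{1..m}. {u. g t k u \<ge> 0})"
    and f: "\<And>t. f t \<in> X t \<times> U t \<rightarrow> X (Suc t)"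
    and \<sigma>: "\<sigma> \<in> X 0"
    and sol: "solves_P1 X U f \<phi> \<sigma> xh uh \<or> solves_P2 X U f \<phi> \<sigma> xh uh \<or>
              solves_P3 X U f \<phi> \<sigma> xh uh"
    and i: "\<And>t. gateaux_differentiable (\<phi> t) (X t \<times> U t) (xh t, uh t)"
           "\<And>t. gateaux_differentiable (f t) (X t \<times> U t) (xh t, uh t)"
    and ii: "\<And>t k. k \<in> {1..m} \<Longrightarrow> gateaux_differentiable (g t k) UNIV (uh t)"
    and iii: "\<And>t \<alpha>. f t (xh t, uh t) $ \<alpha> > xh (Suc t) $ \<alpha> \<Longrightarrow>
                lsc_at (\<lambda>z. f t z $ \<alpha>) (X t \<times> U t) (xh t, uh t)"
    and iv: "\<And>t k. k \<in> {1..m} \<Longrightarrow> g t k (uh t) > 0 \<Longrightarrow> lsc_at (g t k) UNIV (uh t)"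
    and v: "\<And>t. 0 \<notin> convex hull
                ((\<lambda>k. DG (g t k) UNIV (uh t)) ` {k \<in> {1..m}. g t k (uh t) = 0})"
    and vi_or_vii:
      "(\<forall>t\<ge>1. invertible (matrix (blinfun_apply (DG1 (f t) (X t \<times> U t) (xh t, uh t))))) \<or>
       (\<forall>t\<ge>1. (\<forall>\<alpha> \<beta>. matrix (blinfun_apply (DG1 (f t) (X t \<times> U t) (xh t, uh t))) $ \<alpha> $ \<beta> \<ge> 0) \<and>
              (\<forall>\<alpha>. matrix (blinfun_apply (DG1 (f t) (X t \<times> U t) (xh t, uh t))) $ \<alpha> $ \<alpha> > 0))"
  shows "\<exists>(l0::real) (p :: nat \<Rightarrow> ((real^'n) \<Rightarrow>\<^sub>L real)) (\<mu> :: nat \<Rightarrow> nat \<Rightarrow> real).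
      (l0, p 1) \<noteq> (0, 0) \<and>
      (l0 \<ge> 0 \<and> (\<forall>t\<ge>1. \<forall>\<alpha>. dual_coord (p t) \<alpha> \<ge> 0) \<and> (\<forall>t. \<forall>k\<in>{1..m}. \<mu> k t \<ge> 0)) \<and>
      (\<forall>t. (\<forall>\<alpha>. dual_coord (p (Suc t)) \<alpha> * (f t (xh t, uh t) $ \<alpha> - xh (Suc t) $ \<alpha>) = 0) \<and>
           (\<forall>k\<in>{1..m}. \<mu> k t * g t k (uh t) = 0)) \<and>
      (\<forall>t\<ge>1. p t = (p (Suc t) o\<^sub>L DG1 (f t) (X t \<times> U t) (xh t, uh t))
                    + l0 *\<^sub>R DG1 (\<phi> t) (X t \<times> U t) (xh t, uh t)) \<and>
      (\<forall>t. (p (Suc t) o\<^sub>L DG2 (f t) (X t \<times> U t) (xh t, uh t))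
             + l0 *\<^sub>R DG2 (\<phi> t) (X t \<times> U t) (xh t, uh t)
             + (\<Sum>k=1..m. \<mu> k t *\<^sub>R DG (g t k) UNIV (uh t)) = 0)"
proof -
  define G where "G = (\<lambda>t k. DG (g t k) UNIV (uh t))"
  define I where "I = (\<lambda>t. {k \<in> {1..m}. g t k (uh t) = 0})"
  define V where "V = (\<lambda>t. {w. \<forall>k\<in>I t. blinfun_apply (G t k) w > 0})"
  \<comment> \<open>Adjoining 0 admits variations that leave the control fixed, which the adjoint
    equation requires.\<close>
  define W where "W = (\<lambda>t. insert 0 (V t))"
  define act where "act = (\<lambda>t \<alpha>. f t (xh t, uh t) $ \<alpha> = xh (Suc t) $ \<alpha>)"
  have finI: "finite (I t)" for t by (simp add: I_def)
  have hull: "0 \<notin> convex hull (G t ` I t)" for t using v by (simp add: G_def I_def)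
  have adm: "\<And>t. xh t \<in> X t" "\<And>t. uh t \<in> U t"
    using solution_in_Adm[OF sol] by (auto simp: Adm_def)
  \<comment> \<open>Any joint derivatives will do: only the partial ones enter the conclusion, and
    these are shown to be unique below.\<close>
  obtain F where F: "\<And>t. has_gateaux_derivative (f t) (F t) (X t \<times> U t) (xh t, uh t)"
    using i(2) unfolding gateaux_differentiable_def by metis
  obtain \<Psi> where \<Psi>: "\<And>t. has_gateaux_derivative (\<phi> t) (\<Psi> t) (X t \<times> U t) (xh t, uh t)"
    using i(1) unfolding gateaux_differentiable_def by metis
  have feasible: "\<forall>\<^sub>F s in at_right 0. uh t + s *\<^sub>R w \<in> U t" if "w \<in> W t" for t w
  proof (cases "w = 0")
    case True
    then show ?thesis using adm(2) by simp
  next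
    case False
    then have "w \<in> V t" using that by (simp add: W_def)
    then show ?thesis
      unfolding U(2) using adm(2)[of t] ii iv
      by (intro feasible_control_direction) (auto simp: U(2) V_def G_def I_def)
  qed
  have "open (V t)" for t
  proof -
    have "V t = (\<Inter>k\<in>I t. {w. 0 < blinfun_apply (G t k) w})" by (auto simp: V_def)
    also have "open \<dots>"
      using finI by (intro open_INT ballI open_Collect_less continuous_intros) auto
    finally show ?thesis .
  qed
  moreover have "V t \<noteq> {}" for t
    using common_positive_direction[OF finI hull, of t] by (auto simp: V_def)
  ultimately have DG2: "blinfun_apply (DG2 (f t) (X t \<times> U t) (xh t, uh t)) w = blinfun_apply (F t) (0, w)"
      "blinfun_apply (DG2 (\<phi> t) (X t \<times> U t) (xh t, uh t)) w = blinfun_apply (\<Psi> t) (0, w)" for t w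
    using DG2_apply[OF F adm(1), of "V t"] DG2_apply[OF \<Psi> adm(1), of "V t"] feasible
    by (auto simp: W_def)
  have DG1: "blinfun_apply (DG1 (f t) (X t \<times> U t) (xh t, uh t)) y = blinfun_apply (F t) (y, 0)"
      "blinfun_apply (DG1 (\<phi> t) (X t \<times> U t) (xh t, uh t)) y = blinfun_apply (\<Psi> t) (y, 0)" for t y
    using DG1_apply[OF F X(1) adm] DG1_apply[OF \<Psi> X(1) adm] by auto
  \<comment> \<open>This is where (vi) or (vii) enters, as the source of the bounds that are uniform
    in the horizon.\<close>
  have diag: "\<exists>z. axis \<alpha> 1 \<le> blinfun_apply (F t) (z, 0)" if "t \<ge> 1" for t \<alpha>
    unfolding DG1(1)[symmetric]
    by (rule axis_le_if_invertible_or_pos_diag[OF bounded_linear.linear[OF blinfun.bounded_linear_right]])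
      (use vi_or_vii that in blast)
  have convW: "convex (W t)" for t
    unfolding convex_def
  proof (intro ballI allI impI)
    fix w w' and a b :: real assume ww: "w \<in> W t" "w' \<in> W t" and ab: "0 \<le> a" "0 \<le> b" "a + b = 1"
    show "a *\<^sub>R w + b *\<^sub>R w' \<in> W t"
    \<comment> \<open>If both scaled vectors vanish, so does their sum. Otherwise each active
      functional is nonnegative on both and positive on a nonzero one, so the sum lies in
      \<open>V t\<close>.\<close>
    proof (cases "a *\<^sub>R w = 0 \<and> b *\<^sub>R w' = 0")
      case True
      then show ?thesis by (simp only: W_def add_0_right insertI1)
    next
      case False
      have "blinfun_apply (G t k) (a *\<^sub>R w + b *\<^sub>R w') > 0" if k: "k \<in> I t" for k
      proof -
        have "0 \<le> a * blinfun_apply (G t k) w" "0 \<le> b * blinfun_apply (G t k) w'"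
          using ww ab k by (auto simp: W_def V_def less_imp_le)
        moreover have "0 < a * blinfun_apply (G t k) w \<or> 0 < b * blinfun_apply (G t k) w'"
          using False ww ab k by (auto simp: W_def V_def less_le)
        ultimately show ?thesis by (auto simp: blinfun.add_right blinfun.scaleR_right)
      qed
      then show ?thesis by (simp add: W_def V_def)
    qed
  qed
  have horizon: "\<exists>(l, p) \<in> multipliers_upto F \<Psi> W act h. l \<noteq> 0 \<or> (\<exists>t\<le>h. p (Suc t) \<noteq> 0)" for h
  proof (rule multipliers_upto_exist[OF convW])
    fix y :: "nat \<Rightarrow> real^'n" and w :: "nat \<Rightarrow> real^'d"
    assume "y 0 = 0" "\<And>t. t > h \<Longrightarrow> y t = 0" and w: "\<And>t. w t \<in> W t"
      and "\<And>t \<alpha>. t \<le> h \<Longrightarrow> act t \<alpha> \<Longrightarrow> (blinfun_apply (F t) (y t, w t) - y (Suc t)) $ \<alpha> > 0"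
    then show "(\<Sum>t\<le>h. blinfun_apply (\<Psi> t) (y t, w t)) \<le> 0"
      using no_first_order_improvement[OF X(1) sol F \<Psi> iii feasible[OF w], of y h]
      by (simp add: act_def)
  qed (simp add: W_def)
  obtain l P where norm1: "l + norm (P 1) = 1"
      and lP: "\<And>h. (l, P) \<in> multipliers_upto F \<Psi> W act h"
    using multipliers_all_horizons[OF diag horizon] by blast
  have l: "l \<ge> 0" and P: "0 \<le> P (Suc t) $ \<alpha>" "\<not> act t \<alpha> \<Longrightarrow> P (Suc t) $ \<alpha> = 0"
      and max: "w \<in> W t \<Longrightarrow> P (Suc t) \<bullet> blinfun_apply (F t) (0, w) + l * blinfun_apply (\<Psi> t) (0, w) \<le> 0" for t \<alpha> w
    using lP[of t] by (auto simp: multipliers_upto_def)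
  have AE: "P t \<bullet> y = P (Suc t) \<bullet> blinfun_apply (F t) (y, 0) + l * blinfun_apply (\<Psi> t) (y, 0)"
    if "t \<ge> 1" for t y
    using lP[of t] that by (auto simp: multipliers_upto_def)
  define p where "p = (\<lambda>t. blinfun_inner_right (P t))"
  define q where "q = (\<lambda>t. (p (Suc t) o\<^sub>L DG2 (f t) (X t \<times> U t) (xh t, uh t))
             + l *\<^sub>R DG2 (\<phi> t) (X t \<times> U t) (xh t, uh t))"
  have q: "blinfun_apply (q t) w = P (Suc t) \<bullet> blinfun_apply (F t) (0, w) + l * blinfun_apply (\<Psi> t) (0, w)" for t w
    by (simp add: q_def p_def blinfun.add_left blinfun.scaleR_left DG2)
  \<comment> \<open>The maximum condition makes \<open>q t\<close> nonpositive on
    \<open>V t\<close>, so the functionals of the active constraints balance it.\<close>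
  have "\<exists>\<nu>. (\<forall>k\<in>I t. 0 \<le> \<nu> k) \<and> q t + (\<Sum>k\<in>I t. \<nu> k *\<^sub>R G t k) = 0" for t
    by (rule farkas_multipliers[OF finI hull]) (use max in \<open>auto simp: q W_def V_def\<close>)
  then obtain \<nu> where \<nu>: "\<And>t k. k \<in> I t \<Longrightarrow> 0 \<le> \<nu> t k"
      "\<And>t. q t + (\<Sum>k\<in>I t. \<nu> t k *\<^sub>R G t k) = 0" by metis
  \<comment> \<open>Extension by 0 off the active set gives complementary slackness for the control
    constraints.\<close>
  define \<mu> where "\<mu> = (\<lambda>k t. if k \<in> I t then \<nu> t k else 0)"
  have sum: "(\<Sum>k=1..m. \<mu> k t *\<^sub>R DG (g t k) UNIV (uh t)) = (\<Sum>k\<in>I t. \<nu> t k *\<^sub>R G t k)" for t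
    by (rule sum.mono_neutral_cong_right) (auto simp: I_def \<mu>_def G_def)
  have coord: "dual_coord (p t) \<alpha> = P t $ \<alpha>" for t \<alpha>
    by (simp add: dual_coord_def p_def inner_axis)
  show ?thesis
  proof (intro exI[of _ l] exI[of _ p] exI[of _ \<mu>] conjI allI impI ballI)
    show "(l, p 1) \<noteq> (0, 0)"
    proof
      assume "(l, p 1) = (0, 0)"
      \<comment> \<open>Evaluating \<open>p 1\<close> at \<open>P 1\<close> gives the squared norm
        of \<open>P 1\<close>, so both summands in \<open>norm1\<close> would be 0.\<close>
      then have "l = 0" "blinfun_apply (p 1) (P 1) = 0" by auto
      then show False using norm1 by (simp add: p_def)
    qed
    show "0 \<le> dual_coord (p t) \<alpha>" if "1 \<le> t" for t \<alpha>
      using P(1)[of "t - 1" \<alpha>] that by (simp add: coord)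
    show "0 \<le> \<mu> k t" for k t using \<nu>(1) by (simp add: \<mu>_def)
    show "dual_coord (p (Suc t)) \<alpha> * (f t (xh t, uh t) $ \<alpha> - xh (Suc t) $ \<alpha>) = 0" for t \<alpha>
      using P(2)[of t \<alpha>] by (auto simp: coord act_def)
    show "\<mu> k t * g t k (uh t) = 0" for k t by (simp add: \<mu>_def I_def)
    show "p t = (p (Suc t) o\<^sub>L DG1 (f t) (X t \<times> U t) (xh t, uh t))
                    + l *\<^sub>R DG1 (\<phi> t) (X t \<times> U t) (xh t, uh t)" if "1 \<le> t" for t
      by (rule blinfun_eqI)
        (simp add: p_def blinfun.add_left blinfun.scaleR_left DG1 AE[OF that])
    show "(p (Suc t) o\<^sub>L DG2 (f t) (X t \<times> U t) (xh t, uh t))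
             + l *\<^sub>R DG2 (\<phi> t) (X t \<times> U t) (xh t, uh t)
             + (\<Sum>k=1..m. \<mu> k t *\<^sub>R DG (g t k) UNIV (uh t)) = 0" for t
      using \<nu>(2)[of t] by (simp only: sum q_def)
  qed (rule l)
qed

end
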